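(* Let $G$ be a Barnette graph whose faces are properly $3$-colored with colors $\{1,2,3\}$, where the outer face of $G$ is a $3$-face. The following are equivalent: (i) $G$ has a hamiltonian cycle $C$ such that all $2$-faces lie inside $C$, all $3$-faces lie outside $C$ (and $1$-faces may lie on either side); (ii) the reduced graph $H$ obtained from $G$ by contracting the $1$-faces has an $A$-trail; (iii) the reduced graph $H'$ obtained from $G$ by contracting the $2$-faces has a spanning tree of faces all of whose faces are $1$-faces; (iv) the reduced graph $H''$ obtained from $G$ by contracting the $3$-faces has a spanning tree of faces all of whose faces are $1$-faces.
   Context: A Barnette graph is a $3$-connected cubic planar bipartite graph (here with a fixed plane embedding). Such a graph has a proper $3$-face-coloring; faces of color $i$ are called $i$-faces, and the boundaries of the $i$-faces form a facial $2$-factor (a spanning $2$-regular subgraph whose cycles are face boundaries). Contracting the $i$-faces means contracting each boundary cycle of an $i$-face to a single vertex, producing a plane multigraph (the reduced graph) whose faces correspond to the faces of $G$ of the other two colors; these faces retain their colors. An $A$-trail of a $2$-connected eulerian plane graph is an eulerian trail in which any two consecutive edges lie on a common face boundary. Radial graph: for a $2$-connected plane graph $H$ with face set $\mathcal{F}(H)$, $\mathcal{R}(H)$ is the bipartite graph on $V(H)\cup\mathcal{F}(H)$ with $x$ adjacent to face $F$ iff $x$ lies on the boundary of $F$. Spanning tree of faces: if $\mathcal{T}$ is a set of bounded faces of $H$ with pairwise edge-disjoint boundaries covering all vertices, and the subgraph of $\mathcal{R}(H)$ induced by $V(H)\cup\mathcal{T}$ is a tree, then the subgraph $H_{\mathcal{T}}$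 formed by the boundary edges of faces of $\mathcal{T}$ is a spanning tree of faces. *)

theory Defs
  imports "HOL-Combinatorics.Permutations" "HOL-Combinatorics.Orbits"
begin

section \<open>Plane (multi)graphs as combinatorial maps\<close>

text \<open>A plane graph is given by a combinatorial map on a finite set of darts D:
  alpha is a fixed-point-free involution (the two darts of an edge), sigma the
  rotation (cyclic order of darts around a vertex). Vertices are sigma-orbits,
  edges are alpha-orbits, faces are orbits of sigma o alpha. Genus 0
  (Euler formula) means the map is a sphere embedding; a designated face
  plays the role of the outer (unbounded) face.\<close>

definition vertex_of :: "('d \<Rightarrow> 'd) \<Rightarrow> 'd \<Rightarrow> 'd set" where
  "vertex_of \<sigma> d = orbit \<sigma> d"

definition edge_of :: "('d \<Rightarrow> 'd) \<Rightarrow> 'd \<Rightarrow> 'd set" where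
  "edge_of \<alpha> d = {d, \<alpha> d}"

definition face_of :: "('d \<Rightarrow> 'd) \<Rightarrow> ('d \<Rightarrow> 'd) \<Rightarrow> 'd \<Rightarrow> 'd set" where
  "face_of \<alpha> \<sigma> d = orbit (\<sigma> \<circ> \<alpha>) d"

definition map_verts :: "'d set \<Rightarrow> ('d \<Rightarrow> 'd) \<Rightarrow> 'd set set" where
  "map_verts D \<sigma> = vertex_of \<sigma> ` D"

definition map_edges :: "'d set \<Rightarrow> ('d \<Rightarrow> 'd) \<Rightarrow> 'd set set" where
  "map_edges D \<alpha> = edge_of \<alpha> ` D"

definition map_faces :: "'d set \<Rightarrow> ('d \<Rightarrow> 'd) \<Rightarrow> ('d \<Rightarrow> 'd) \<Rightarrow> 'd set set" where
  "map_faces D \<alpha> \<sigma> = face_of \<alpha> \<sigma> ` D"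

definition comb_map :: "'d set \<Rightarrow> ('d \<Rightarrow> 'd) \<Rightarrow> ('d \<Rightarrow> 'd) \<Rightarrow> bool" where
  "comb_map D \<alpha> \<sigma> \<longleftrightarrow> finite D \<and> D \<noteq> {} \<and> \<alpha> permutes D \<and> \<sigma> permutes D
     \<and> (\<forall>d\<in>D. \<alpha> (\<alpha> d) = d \<and> \<alpha> d \<noteq> d)"

definition map_connected :: "'d set \<Rightarrow> ('d \<Rightarrow> 'd) \<Rightarrow> ('d \<Rightarrow> 'd) \<Rightarrow> bool" where
  "map_connected D \<alpha> \<sigma> \<longleftrightarrow>
     (\<forall>d\<in>D. \<forall>d'\<in>D. (d, d') \<in> {(x, y). x \<in> D \<and> (y = \<alpha> x \<or> y = \<sigma> x)}\<^sup>*)"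

definition plane_map :: "'d set \<Rightarrow> ('d \<Rightarrow> 'd) \<Rightarrow> ('d \<Rightarrow> 'd) \<Rightarrow> bool" where
  "plane_map D \<alpha> \<sigma> \<longleftrightarrow> comb_map D \<alpha> \<sigma> \<and> map_connected D \<alpha> \<sigma> \<and>
     int (card (map_verts D \<sigma>)) - int (card (map_edges D \<alpha>))
       + int (card (map_faces D \<alpha> \<sigma>)) = 2"

section \<open>Simple graphs given by an adjacency predicate on a vertex set\<close>

definition sg_connected :: "'v set \<Rightarrow> ('v \<Rightarrow> 'v \<Rightarrow> bool) \<Rightarrow> bool" where
  "sg_connected W adj \<longleftrightarrow>
     (\<forall>u\<in>W. \<forall>w\<in>W. (u, w) \<in> {(a, b). a \<in> W \<and> b \<in> W \<and> adj a b}\<^sup>*)"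

definition sg_acyclic :: "'v set \<Rightarrow> ('v \<Rightarrow> 'v \<Rightarrow> bool) \<Rightarrow> bool" where
  "sg_acyclic W adj \<longleftrightarrow>
     \<not> (\<exists>cyc. length cyc \<ge> 3 \<and> distinct cyc \<and> set cyc \<subseteq> W \<and>
          (\<forall>i<length cyc. adj (cyc ! i) (cyc ! ((i + 1) mod length cyc))))"

definition sg_tree :: "'v set \<Rightarrow> ('v \<Rightarrow> 'v \<Rightarrow> bool) \<Rightarrow> bool" where
  "sg_tree W adj \<longleftrightarrow> W \<noteq> {} \<and> sg_connected W adj \<and> sg_acyclic W adj"

section \<open>Barnette graphs\<close>

text \<open>Adjacency of vertices (sigma-orbits) in the underlying graph.\<close>
definition map_vadj :: "('d \<Rightarrow> 'd) \<Rightarrow> ('d \<Rightarrow> 'd) \<Rightarrow> 'd set \<Rightarrow> 'd set \<Rightarrow> bool" where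
  "map_vadj \<alpha> \<sigma> u w \<longleftrightarrow> (\<exists>d\<in>u. vertex_of \<sigma> (\<alpha> d) = w)"

definition map_simple :: "'d set \<Rightarrow> ('d \<Rightarrow> 'd) \<Rightarrow> ('d \<Rightarrow> 'd) \<Rightarrow> bool" where
  "map_simple D \<alpha> \<sigma> \<longleftrightarrow>
     (\<forall>d\<in>D. vertex_of \<sigma> (\<alpha> d) \<noteq> vertex_of \<sigma> d) \<and>
     (\<forall>d\<in>D. \<forall>d'\<in>D. vertex_of \<sigma> d = vertex_of \<sigma> d' \<and>
         vertex_of \<sigma> (\<alpha> d) = vertex_of \<sigma> (\<alpha> d') \<longrightarrow> d = d')"

definition map_cubic :: "'d set \<Rightarrow> ('d \<Rightarrow> 'd) \<Rightarrow> bool" where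
  "map_cubic D \<sigma> \<longleftrightarrow> (\<forall>d\<in>D. card (vertex_of \<sigma> d) = 3)"

definition map_bipartite :: "'d set \<Rightarrow> ('d \<Rightarrow> 'd) \<Rightarrow> ('d \<Rightarrow> 'd) \<Rightarrow> bool" where
  "map_bipartite D \<alpha> \<sigma> \<longleftrightarrow>
     (\<exists>c :: 'd set \<Rightarrow> bool. \<forall>d\<in>D. c (vertex_of \<sigma> d) \<noteq> c (vertex_of \<sigma> (\<alpha> d)))"

definition map_3_connected :: "'d set \<Rightarrow> ('d \<Rightarrow> 'd) \<Rightarrow> ('d \<Rightarrow> 'd) \<Rightarrow> bool" where
  "map_3_connected D \<alpha> \<sigma> \<longleftrightarrow> card (map_verts D \<sigma>) \<ge> 4 \<and>
     (\<forall>S \<subseteq> map_verts D \<sigma>. card S \<le> 2 \<longrightarrow>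
        sg_connected (map_verts D \<sigma> - S) (map_vadj \<alpha> \<sigma>))"

definition barnette :: "'d set \<Rightarrow> ('d \<Rightarrow> 'd) \<Rightarrow> ('d \<Rightarrow> 'd) \<Rightarrow> bool" where
  "barnette D \<alpha> \<sigma> \<longleftrightarrow> plane_map D \<alpha> \<sigma> \<and> map_simple D \<alpha> \<sigma> \<and> map_cubic D \<sigma> \<and>
     map_bipartite D \<alpha> \<sigma> \<and> map_3_connected D \<alpha> \<sigma>"

definition proper_face_3_coloring ::
  "'d set \<Rightarrow> ('d \<Rightarrow> 'd) \<Rightarrow> ('d \<Rightarrow> 'd) \<Rightarrow> ('d set \<Rightarrow> nat) \<Rightarrow> bool" where
  "proper_face_3_coloring D \<alpha> \<sigma> col \<longleftrightarrow>
     (\<forall>F\<in>map_faces D \<alpha> \<sigma>. col F \<in> {1, 2, 3}) \<and>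
     (\<forall>d\<in>D. col (face_of \<alpha> \<sigma> d) \<noteq> col (face_of \<alpha> \<sigma> (\<alpha> d)))"

section \<open>Hamiltonian cycles and their sides\<close>

definition ham_cycle :: "'d set \<Rightarrow> ('d \<Rightarrow> 'd) \<Rightarrow> ('d \<Rightarrow> 'd) \<Rightarrow> 'd set set \<Rightarrow> bool" where
  "ham_cycle D \<alpha> \<sigma> C \<longleftrightarrow> C \<subseteq> map_edges D \<alpha> \<and>
     (\<forall>v\<in>map_verts D \<sigma>. card {e\<in>C. e \<inter> v \<noteq> {}} = 2) \<and>
     sg_connected (map_verts D \<sigma>) (\<lambda>u w. u \<noteq> w \<and> (\<exists>e\<in>C. e \<inter> u \<noteq> {} \<and> e \<inter> w \<noteq> {}))"

text \<open>Faces lying outside the cycle C: those reachable from the outer face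
  in the dual graph without crossing an edge of C.\<close>
definition outside_faces ::
  "'d set \<Rightarrow> ('d \<Rightarrow> 'd) \<Rightarrow> ('d \<Rightarrow> 'd) \<Rightarrow> 'd set set \<Rightarrow> 'd set \<Rightarrow> 'd set set" where
  "outside_faces D \<alpha> \<sigma> C outer =
     {F. (outer, F) \<in> {(F1, F2). \<exists>d\<in>D. face_of \<alpha> \<sigma> d = F1 \<and>
          face_of \<alpha> \<sigma> (\<alpha> d) = F2 \<and> edge_of \<alpha> d \<notin> C}\<^sup>*}"

section \<open>Abstract plane multigraphs with faces: A-trails and spanning trees of faces\<close>

text \<open>V vertices, E edges, ends e = set of end vertices of e (one element for a
  loop), Fs faces, fe f e: e lies on the boundary of f, fv f v: v lies on the
  boundary of f.\<close>

definition is_A_trail ::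
  "'v set \<Rightarrow> 'e set \<Rightarrow> ('e \<Rightarrow> 'v set) \<Rightarrow> 'f set \<Rightarrow> ('f \<Rightarrow> 'e \<Rightarrow> bool)
    \<Rightarrow> 'e list \<Rightarrow> 'v list \<Rightarrow> bool" where
  "is_A_trail V E ends Fs fe es vs \<longleftrightarrow>
     (let m = length es in
        m > 0 \<and> length vs = m \<and> distinct es \<and> set es = E \<and> set vs \<subseteq> V \<and>
        (\<forall>i<m. ends (es ! i) = {vs ! i, vs ! ((i + 1) mod m)}) \<and>
        (\<forall>i<m. \<exists>f\<in>Fs. fe f (es ! i) \<and> fe f (es ! ((i + 1) mod m))))"

definition has_A_trail ::
  "'v set \<Rightarrow> 'e set \<Rightarrow> ('e \<Rightarrow> 'v set) \<Rightarrow> 'f set \<Rightarrow> ('f \<Rightarrow> 'e \<Rightarrow> bool) \<Rightarrow> bool" where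
  "has_A_trail V E ends Fs fe \<longleftrightarrow> (\<exists>es vs. is_A_trail V E ends Fs fe es vs)"

definition radial_adj :: "('f \<Rightarrow> 'v \<Rightarrow> bool) \<Rightarrow> ('v + 'f) \<Rightarrow> ('v + 'f) \<Rightarrow> bool" where
  "radial_adj fv x y = (case (x, y) of
       (Inl v, Inr f) \<Rightarrow> fv f v
     | (Inr f, Inl v) \<Rightarrow> fv f v
     | _ \<Rightarrow> False)"

definition is_spanning_tree_of_faces ::
  "'v set \<Rightarrow> 'f set \<Rightarrow> ('f \<Rightarrow> 'e \<Rightarrow> bool) \<Rightarrow> ('f \<Rightarrow> 'v \<Rightarrow> bool) \<Rightarrow> 'f \<Rightarrow> 'f set \<Rightarrow> bool" where
  "is_spanning_tree_of_faces V Fs fe fv outer T \<longleftrightarrow>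
     T \<subseteq> Fs - {outer} \<and>
     (\<forall>f\<in>T. \<forall>f'\<in>T. f \<noteq> f' \<longrightarrow> \<not> (\<exists>e. fe f e \<and> fe f' e)) \<and>
     (\<forall>v\<in>V. \<exists>f\<in>T. fv f v) \<and>
     sg_tree (Inl ` V \<union> Inr ` T) (radial_adj fv)"

section \<open>The reduced graph obtained by contracting the i-faces\<close>

text \<open>Vertices: the i-faces of G; edges: the edges of G not on the boundary of
  any i-face; the ends of such an edge are the i-faces through its end
  vertices; faces: the faces of G of the other two colours, keeping the
  remaining (uncontracted) edges on their boundary; a contracted i-face X lies on the
  boundary of a face F iff F and X share a vertex of G.\<close>

definition red_verts :: "'d set \<Rightarrow> ('d \<Rightarrow> 'd) \<Rightarrow> ('d \<Rightarrow> 'd) \<Rightarrow> ('d set \<Rightarrow> nat) \<Rightarrow> nat \<Rightarrow> 'd set set" where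
  "red_verts D \<alpha> \<sigma> col i = {F\<in>map_faces D \<alpha> \<sigma>. col F = i}"

definition red_edges :: "'d set \<Rightarrow> ('d \<Rightarrow> 'd) \<Rightarrow> ('d \<Rightarrow> 'd) \<Rightarrow> ('d set \<Rightarrow> nat) \<Rightarrow> nat \<Rightarrow> 'd set set" where
  "red_edges D \<alpha> \<sigma> col i =
     {e\<in>map_edges D \<alpha>. \<forall>F\<in>map_faces D \<alpha> \<sigma>. col F = i \<longrightarrow> e \<inter> F = {}}"

definition red_ends :: "'d set \<Rightarrow> ('d \<Rightarrow> 'd) \<Rightarrow> ('d \<Rightarrow> 'd) \<Rightarrow> ('d set \<Rightarrow> nat) \<Rightarrow> nat \<Rightarrow> 'd set \<Rightarrow> 'd set set" where
  "red_ends D \<alpha> \<sigma> col i e =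
     {X\<in>red_verts D \<alpha> \<sigma> col i. \<exists>d\<in>e. X \<inter> vertex_of \<sigma> d \<noteq> {}}"

definition red_faces :: "'d set \<Rightarrow> ('d \<Rightarrow> 'd) \<Rightarrow> ('d \<Rightarrow> 'd) \<Rightarrow> ('d set \<Rightarrow> nat) \<Rightarrow> nat \<Rightarrow> 'd set set" where
  "red_faces D \<alpha> \<sigma> col i = {F\<in>map_faces D \<alpha> \<sigma>. col F \<noteq> i}"

definition red_fe :: "'d set \<Rightarrow> ('d \<Rightarrow> 'd) \<Rightarrow> ('d \<Rightarrow> 'd) \<Rightarrow> ('d set \<Rightarrow> nat) \<Rightarrow> nat \<Rightarrow> 'd set \<Rightarrow> 'd set \<Rightarrow> bool" where
  "red_fe D \<alpha> \<sigma> col i F e \<longleftrightarrow> e \<in> red_edges D \<alpha> \<sigma> col i \<and> e \<inter> F \<noteq> {}"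

definition red_fv :: "'d set \<Rightarrow> ('d \<Rightarrow> 'd) \<Rightarrow> 'd set \<Rightarrow> 'd set \<Rightarrow> bool" where
  "red_fv D \<sigma> F X \<longleftrightarrow> (\<exists>d\<in>D. vertex_of \<sigma> d \<inter> F \<noteq> {} \<and> vertex_of \<sigma> d \<inter> X \<noteq> {})"

definition reduced_has_A_trail :: "'d set \<Rightarrow> ('d \<Rightarrow> 'd) \<Rightarrow> ('d \<Rightarrow> 'd) \<Rightarrow> ('d set \<Rightarrow> nat) \<Rightarrow> nat \<Rightarrow> bool" where
  "reduced_has_A_trail D \<alpha> \<sigma> col i \<longleftrightarrow>
     has_A_trail (red_verts D \<alpha> \<sigma> col i) (red_edges D \<alpha> \<sigma> col i) (red_ends D \<alpha> \<sigma> col i)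
       (red_faces D \<alpha> \<sigma> col i) (red_fe D \<alpha> \<sigma> col i)"

text \<open>The reduced graph (contracting the i-faces) has a spanning tree of faces
  all of whose faces have colour j; bounded = different from the outer face of G.\<close>
definition reduced_has_sptf :: "'d set \<Rightarrow> ('d \<Rightarrow> 'd) \<Rightarrow> ('d \<Rightarrow> 'd) \<Rightarrow> ('d set \<Rightarrow> nat) \<Rightarrow> 'd set \<Rightarrow> nat \<Rightarrow> nat \<Rightarrow> bool" where
  "reduced_has_sptf D \<alpha> \<sigma> col outer i j \<longleftrightarrow>
     (\<exists>T. is_spanning_tree_of_faces (red_verts D \<alpha> \<sigma> col i) (red_faces D \<alpha> \<sigma> col i)
            (red_fe D \<alpha> \<sigma> col i) (red_fv D \<sigma>) outer T \<and> (\<forall>F\<in>T. col F = j))"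

end

theory Submission
  imports Defs "HOL-Library.Transitive_Closure_Table"
begin

text \<open>All four conditions say that for some set \<open>T\<close> of 1-faces the boundary of the region formed
  by the 2-faces and \<open>T\<close> is connected: this boundary contains every edge between a 2-face and a
  3-face and, on each 1-face, every second edge, so it is 2-regular. Its edges off the 1-faces, in the
  order in which the boundary passes them, are the A-trail. Condition (iv) arises by passing to the
  complementary region. If the boundary is a single cycle, then walking along it shows that the dual
  graphs of both sides are connected, and Euler's formula leaves just enough edges for two trees.
  Conversely, for a tree of faces, a set of vertices closed under the boundary is cut by an even set
  of tree edges, which must be empty. 3-connectedness enters through the fact that two faces share at
  most one edge, which makes the radial graph and the corners of the reduced graphs unambiguous.\<close>

section \<open>Counting\<close>

lemma card_eq_mult_card_image:
  assumes "finite A" "\<And>x. x \<in> A \<Longrightarrow> card {y\<in>A. f y = f x} = k"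
  shows "card A = k * card (f ` A)"
proof -
  have "card A = (\<Sum>z\<in>f ` A. card {y\<in>A. f y = z})"
    using sum.image_gen[OF assms(1), of "\<lambda>_. 1::nat" f] by simp
  also have "\<dots> = (\<Sum>z\<in>f ` A. k)" by (rule sum.cong) (auto simp: assms(2))
  finally show ?thesis by simp
qed

lemma even_card_orbit_changes:
  fixes P :: "'a \<Rightarrow> bool"
  assumes "permutation f" shows "even (card {x\<in>orbit f d. P x \<noteq> P (f x)})"
proof -
  let ?O = "orbit f d"
  let ?A = "{x\<in>?O. P x}" and ?B = "{x\<in>?O. P (f x)}"
  have fin: "finite ?O" using assms by (intro finite_orbit permutation_self_in_orbit)
  have inj: "inj_on f A" for A
    using permutation_bijective[OF assms] by (metis bij_is_inj inj_on_subset subset_UNIV)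
  have "f ` ?O = ?O" using inj by (intro endo_inj_surj fin) (auto intro: orbit.step)
  then have "f ` ?B = ?A" by auto
  then have "card ?A = card ?B" using card_image[OF inj, of ?B] by simp
  moreover have "card ?A = card (?A - ?B) + card (?A \<inter> ?B)"
    "card ?B = card (?B - ?A) + card (?A \<inter> ?B)"
    using fin by (auto simp: card_Diff_subset_Int Int_commute card_mono)
  moreover have "{x\<in>?O. P x \<noteq> P (f x)} = (?A - ?B) \<union> (?B - ?A)" by auto
  moreover have "card ((?A - ?B) \<union> (?B - ?A)) = card (?A - ?B) + card (?B - ?A)"
    using fin by (intro card_Un_disjoint) auto
  ultimately show ?thesis by simp
qed

section \<open>Multigraphs given by a fixed-point-free involution\<close>

text \<open>The edges are the pairs \<open>{d, \<alpha> d}\<close>, and a function \<open>p\<close> sends each dart to the vertex it starts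
  from. Taking \<open>p\<close> to be \<^const>\<open>vertex_of\<close> or \<^const>\<open>face_of\<close> yields the graph of a combinatorial
  map or its dual.\<close>

locale dart_involution =
  fixes D :: "'d set" and \<alpha> :: "'d \<Rightarrow> 'd"
  assumes finite_darts: "finite D"
    and inv_permutes: "\<alpha> permutes D"
    and inv_inv_dart: "d \<in> D \<Longrightarrow> \<alpha> (\<alpha> d) = d"
    and inv_neq: "d \<in> D \<Longrightarrow> \<alpha> d \<noteq> d"
begin

lemma inv_in_iff [simp]: "\<alpha> d \<in> D \<longleftrightarrow> d \<in> D"
  using inv_permutes by (simp add: permutes_in_image)

lemma inv_inv [simp]: "\<alpha> (\<alpha> d) = d"
  using inv_permutes by (cases "d \<in> D") (auto simp: inv_inv_dart permutes_not_in)

lemma inv_eq_iff [simp]: "\<alpha> x = \<alpha> y \<longleftrightarrow> x = y"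
  by (metis inv_inv)

definition inv_closed :: "'d set \<Rightarrow> bool" where
  "inv_closed B \<longleftrightarrow> B \<subseteq> D \<and> (\<forall>d\<in>B. \<alpha> d \<in> B)"

definition dart_rel :: "('d \<Rightarrow> 'v) \<Rightarrow> 'd set \<Rightarrow> ('v \<times> 'v) set" where
  "dart_rel p B = {(p d, p (\<alpha> d)) | d. d \<in> B}"

definition dart_connected :: "('d \<Rightarrow> 'v) \<Rightarrow> 'd set \<Rightarrow> 'v set \<Rightarrow> bool" where
  "dart_connected p B V \<longleftrightarrow> (\<forall>u\<in>V. \<forall>v\<in>V. (u, v) \<in> (dart_rel p B)\<^sup>*)"

definition all_bridges :: "('d \<Rightarrow> 'v) \<Rightarrow> 'd set \<Rightarrow> bool" where
  "all_bridges p B \<longleftrightarrow> (\<forall>d\<in>B. \<not> dart_connected p (B - {d, \<alpha> d}) {p d, p (\<alpha> d)})"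

definition dart_tree :: "('d \<Rightarrow> 'v) \<Rightarrow> 'd set \<Rightarrow> 'v set \<Rightarrow> bool" where
  "dart_tree p B V \<longleftrightarrow> dart_connected p B V \<and> all_bridges p B"

lemma inv_closedD: "inv_closed B \<Longrightarrow> \<alpha> d \<in> B \<longleftrightarrow> d \<in> B"
  unfolding inv_closed_def by (metis inv_inv)

lemma inv_closed_subset: "inv_closed B \<Longrightarrow> B \<subseteq> D"
  by (simp add: inv_closed_def)

lemma inv_closed_finite: "inv_closed B \<Longrightarrow> finite B"
  using finite_darts finite_subset by (auto simp: inv_closed_def)

lemma inv_closed_darts: "inv_closed D"
  by (simp add: inv_closed_def)

lemma inv_closed_Diff: "inv_closed A \<Longrightarrow> inv_closed B \<Longrightarrow> inv_closed (A - B)"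
  unfolding inv_closed_def by (metis Diff_iff inv_inv subset_iff)

lemma inv_closed_delete_edge: "inv_closed B \<Longrightarrow> d \<in> B \<Longrightarrow> inv_closed (B - {d, \<alpha> d})"
  by (rule inv_closed_Diff) (auto simp: inv_closed_def)

lemma inv_closed_delete_two_edges:
  assumes "d \<in> D" "d' \<in> D" shows "inv_closed (D - {d, \<alpha> d, d', \<alpha> d'})"
proof -
  have "inv_closed {d, \<alpha> d, d', \<alpha> d'}" using assms by (auto simp: inv_closed_def)
  with inv_closed_darts show ?thesis by (rule inv_closed_Diff)
qed

lemma edge_of_inv [simp]: "edge_of \<alpha> (\<alpha> d) = edge_of \<alpha> d"
  by (auto simp: edge_of_def)

lemma edge_of_eq_iff: "edge_of \<alpha> x = edge_of \<alpha> y \<longleftrightarrow> x = y \<or> x = \<alpha> y"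
  by (auto simp: edge_of_def doubleton_eq_iff)

lemma edge_of_image_iff:
  assumes "inv_closed B" shows "edge_of \<alpha> d \<in> edge_of \<alpha> ` B \<longleftrightarrow> d \<in> B"
  using inv_closedD[OF assms] by (auto simp: edge_of_eq_iff)

lemma card_eq_twice_card_edges:
  assumes "inv_closed B" shows "card B = 2 * card (edge_of \<alpha> ` B)"
proof (rule card_eq_mult_card_image[OF inv_closed_finite[OF assms]])
  fix x assume "x \<in> B"
  then have "{y\<in>B. edge_of \<alpha> y = edge_of \<alpha> x} = {x, \<alpha> x}" "\<alpha> x \<noteq> x"
    using inv_closedD[OF assms] inv_closed_subset[OF assms] inv_neq by (auto simp: edge_of_eq_iff)
  then show "card {y\<in>B. edge_of \<alpha> y = edge_of \<alpha> x} = 2" by simp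
qed

lemma even_card_inv_closed: "inv_closed B \<Longrightarrow> even (card B)"
  by (simp add: card_eq_twice_card_edges)

lemma dart_relI: "d \<in> B \<Longrightarrow> (p d, p (\<alpha> d)) \<in> dart_rel p B"
  by (auto simp: dart_rel_def)

lemma dart_rel_sym: "inv_closed B \<Longrightarrow> (u, v) \<in> dart_rel p B \<Longrightarrow> (v, u) \<in> dart_rel p B"
  unfolding dart_rel_def inv_closed_def by clarsimp (metis inv_inv)

lemma dart_connectedI:
  assumes "inv_closed B"
    and "\<And>Q u v. (\<And>d. d \<in> B \<Longrightarrow> Q (p d) \<longleftrightarrow> Q (p (\<alpha> d))) \<Longrightarrow> u \<in> V \<Longrightarrow> v \<in> V \<Longrightarrow> Q u \<Longrightarrow> Q v"
  shows "dart_connected p B V"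
  unfolding dart_connected_def
proof (intro ballI)
  fix u v assume "u \<in> V" "v \<in> V"
  let ?Q = "\<lambda>w. (u, w) \<in> (dart_rel p B)\<^sup>*"
  have step: "?Q (p (\<alpha> d))" if "d \<in> B" "?Q (p d)" for d
    using that dart_relI by (metis rtrancl_into_rtrancl)
  have "?Q (p d) \<longleftrightarrow> ?Q (p (\<alpha> d))" if "d \<in> B" for d
    using step[of d] step[of "\<alpha> d"] that inv_closedD[OF assms(1)] by auto
  then show "?Q v" using assms(2)[of ?Q u v] \<open>u \<in> V\<close> \<open>v \<in> V\<close> by simp
qed

lemma dart_connectedD:
  assumes "dart_connected p B V" "\<And>d. d \<in> B \<Longrightarrow> Q (p d) \<longleftrightarrow> Q (p (\<alpha> d))" "u \<in> V" "v \<in> V"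
  shows "Q u \<longleftrightarrow> Q v"
proof -
  have "(u, v) \<in> (dart_rel p B)\<^sup>*" using assms by (auto simp: dart_connected_def)
  then show ?thesis by (induction rule: rtrancl_induct) (use assms(2) in \<open>auto simp: dart_rel_def\<close>)
qed

lemma dart_connected_mono:
  assumes "dart_connected p A V" "A \<subseteq> B" shows "dart_connected p B V"
proof -
  have "dart_rel p A \<subseteq> dart_rel p B" using assms(2) by (auto simp: dart_rel_def)
  from rtrancl_mono[OF this] show ?thesis using assms(1) by (auto simp: dart_connected_def)
qed

lemma dart_connected_delete_edge:
  assumes "inv_closed B" "d \<in> B" "dart_connected p B V"
    and "dart_connected p (B - {d, \<alpha> d}) {p d, p (\<alpha> d)}"
  shows "dart_connected p (B - {d, \<alpha> d}) V"
proof (rule dart_connectedI)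
  show "inv_closed (B - {d, \<alpha> d})" using assms(1,2) by (rule inv_closed_delete_edge)
  fix Q u v assume const: "\<And>x. x \<in> B - {d, \<alpha> d} \<Longrightarrow> Q (p x) \<longleftrightarrow> Q (p (\<alpha> x))" and "u \<in> V" "v \<in> V" "Q u"
  have "Q (p d) \<longleftrightarrow> Q (p (\<alpha> d))" using dart_connectedD[OF assms(4), of Q] const by blast
  then have "Q (p x) \<longleftrightarrow> Q (p (\<alpha> x))" if "x \<in> B" for x
    using const[of x] that by (cases "x \<in> {d, \<alpha> d}") auto
  from dart_connectedD[OF assms(3) this] show "Q v" using \<open>u \<in> V\<close> \<open>v \<in> V\<close> \<open>Q u\<close> by blast
qed

lemma ex_dart_tree:
  assumes "inv_closed B" "dart_connected p B V"
  shows "\<exists>A\<subseteq>B. inv_closed A \<and> dart_tree p A V"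
  using inv_closed_finite[OF assms(1)] assms
proof (induction B rule: finite_psubset_induct)
  case (psubset B)
  show ?case
  proof (cases "all_bridges p B")
    case False
    then obtain d where d: "d \<in> B" "dart_connected p (B - {d, \<alpha> d}) {p d, p (\<alpha> d)}"
      by (auto simp: all_bridges_def)
    let ?B = "B - {d, \<alpha> d}"
    have "inv_closed ?B" using psubset.prems(1) d(1) by (rule inv_closed_delete_edge)
    moreover have "dart_connected p ?B V"
      using psubset.prems(1) d(1) psubset.prems(2) d(2) by (rule dart_connected_delete_edge)
    moreover have "?B \<subset> B" using d(1) by auto
    ultimately obtain A where "A \<subseteq> ?B" "inv_closed A" "dart_tree p A V"
      using psubset.IH[of ?B] by auto
    then show ?thesis by blast
  qed (use psubset.prems in \<open>auto simp: dart_tree_def\<close>)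
qed

lemma dart_connected_card:
  assumes "inv_closed B" "p ` B \<subseteq> V" "finite V" "dart_connected p B V"
  shows "2 * card V \<le> card B + 2"
proof (cases "V = {}")
  case False
  let ?inner = "\<lambda>W. {d\<in>B. p d \<in> W \<and> p (\<alpha> d) \<in> W}"
  have "\<exists>W\<subseteq>V. card W = Suc k \<and> 2 * k \<le> card (?inner W)" if "k < card V" for k
    using that
  proof (induction k)
    case 0
    then obtain v where "v \<in> V" using False by blast
    then show ?case by (intro exI[of _ "{v}"]) auto
  next
    case (Suc k)
    then obtain W where W: "W \<subseteq> V" "card W = Suc k" "2 * k \<le> card (?inner W)" by auto
    have finW: "finite W" using W(1) assms(3) by (rule finite_subset)
    have "W \<noteq> V" "W \<noteq> {}" using W(2) Suc.prems by auto
    then obtain v w where "v \<in> V" "v \<notin> W" "w \<in> W" using W(1) by blast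
    then obtain g where g: "g \<in> B" "p g \<in> W" "p (\<alpha> g) \<notin> W"
      using dart_connectedD[OF assms(4), of "\<lambda>x. x \<in> W" w v] W(1) inv_closedD[OF assms(1)]
      by (metis inv_inv subsetD)
    let ?W = "insert (p (\<alpha> g)) W"
    have g': "\<alpha> g \<in> B" "\<alpha> g \<noteq> g"
      using g(1) inv_closedD[OF assms(1)] inv_neq inv_closed_subset[OF assms(1)] by auto
    have "card ({g, \<alpha> g} \<union> ?inner W) = 2 + card (?inner W)"
      using g g' inv_closed_finite[OF assms(1)] by (subst card_Un_disjoint) auto
    moreover have "card ({g, \<alpha> g} \<union> ?inner W) \<le> card (?inner ?W)"
      using g g' inv_closed_finite[OF assms(1)] by (intro card_mono) auto
    ultimately have "2 * Suc k \<le> card (?inner ?W)" using W(3) by simp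
    moreover have "?W \<subseteq> V" "card ?W = Suc (Suc k)" using W(1,2) g(3) g' assms(2) finW by auto
    ultimately show ?case by blast
  qed
  moreover have "card V - 1 < card V" using False assms(3) by (simp add: card_gt_0_iff)
  ultimately obtain W where "2 * (card V - 1) \<le> card (?inner W)" by blast
  also have "\<dots> \<le> card B" using inv_closed_finite[OF assms(1)] by (intro card_mono) auto
  finally show ?thesis by simp
qed simp

lemma dart_tree_if_card_le:
  assumes "inv_closed B" "p ` B \<subseteq> V" "finite V" "dart_connected p B V" "card B + 2 \<le> 2 * card V"
  shows "dart_tree p B V"
proof -
  have False if d: "d \<in> B" "dart_connected p (B - {d, \<alpha> d}) {p d, p (\<alpha> d)}" for d
  proof -
    have "inv_closed (B - {d, \<alpha> d})" using assms(1) d(1) by (rule inv_closed_delete_edge)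
    then have "2 * card V \<le> card (B - {d, \<alpha> d}) + 2"
      using assms dart_connected_delete_edge[OF assms(1) d(1) assms(4) d(2)]
      by (intro dart_connected_card[of _ p]) auto
    moreover have "card (B - {d, \<alpha> d}) < card B"
      using d(1) inv_closed_finite[OF assms(1)] by (intro psubset_card_mono) auto
    ultimately show False using assms(5) by simp
  qed
  then show ?thesis using assms(4) by (auto simp: dart_tree_def all_bridges_def)
qed

lemma all_bridgesE:
  assumes "inv_closed B" "all_bridges p B" "d \<in> B"
  obtains Q where "\<And>x. x \<in> B - {d, \<alpha> d} \<Longrightarrow> Q (p x) \<longleftrightarrow> Q (p (\<alpha> x))" "Q (p d)" "\<not> Q (p (\<alpha> d))"
proof -
  have "inv_closed (B - {d, \<alpha> d})" using assms(1,3) by (rule inv_closed_delete_edge)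
  moreover have "\<not> dart_connected p (B - {d, \<alpha> d}) {p d, p (\<alpha> d)}"
    using assms(2,3) by (simp add: all_bridges_def)
  ultimately obtain Q u v where const: "\<And>x. x \<in> B - {d, \<alpha> d} \<Longrightarrow> Q (p x) \<longleftrightarrow> Q (p (\<alpha> x))"
    and uv: "u \<in> {p d, p (\<alpha> d)}" "v \<in> {p d, p (\<alpha> d)}" "Q u" "\<not> Q v"
    using dart_connectedI[of "B - {d, \<alpha> d}" p "{p d, p (\<alpha> d)}"] by blast
  show thesis
  proof (cases "Q (p d)")
    case True
    with uv show thesis using that[OF const] by auto
  next
    case False
    with uv show thesis using that[of "\<lambda>w. \<not> Q w"] const by auto
  qed
qed

lemma even_subset_of_bridges_empty:
  assumes "inv_closed B" "all_bridges p B" "inv_closed N" "N \<subseteq> B"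
    and even: "\<And>v. v \<in> p ` N \<Longrightarrow> even (card {d\<in>N. p d = v})"
  shows "N = {}"
proof (rule ccontr)
  assume "N \<noteq> {}"
  then obtain d where d: "d \<in> N" by auto
  then obtain Q where const: "\<And>x. x \<in> B - {d, \<alpha> d} \<Longrightarrow> Q (p x) \<longleftrightarrow> Q (p (\<alpha> x))"
    and Q: "Q (p d)" "\<not> Q (p (\<alpha> d))"
    using all_bridgesE[OF assms(1,2) subsetD[OF assms(4) d]] by blast
  let ?M = "{x\<in>N. Q (p x)}"
  have finM: "finite ?M" using inv_closed_finite[OF assms(3)] by simp
  have "card ?M = (\<Sum>v\<in>p ` ?M. card {x\<in>?M. p x = v})"
    using sum.image_gen[OF finM, of "\<lambda>_. 1::nat" p] by simp
  also have "\<dots> = (\<Sum>v\<in>p ` ?M. card {x\<in>N. p x = v})"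
    by (intro sum.cong refl arg_cong[where f = card]) auto
  finally have "even (card ?M)" using even by (auto intro!: dvd_sum)
  moreover have "inv_closed (?M - {d})"
    unfolding inv_closed_def
  proof (intro conjI ballI)
    fix x assume x: "x \<in> ?M - {d}"
    then have "x \<noteq> \<alpha> d" using Q(2) by auto
    moreover from this have "Q (p (\<alpha> x))" using const x assms(4) by auto
    ultimately show "\<alpha> x \<in> ?M - {d}" using x inv_closedD[OF assms(3)] inv_inv[of x] by auto
  qed (use inv_closed_subset[OF assms(3)] in auto)
  then have "even (card (?M - {d}))" by (rule even_card_inv_closed)
  moreover have "card ?M = Suc (card (?M - {d}))" using card_Suc_Diff1[OF finM, of d] d Q(1) by simp
  ultimately show False by simp
qed

section \<open>Trees\<close>

lemma all_bridges_imp_sg_acyclic: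
  assumes "inv_closed B" "all_bridges p B"
  shows "sg_acyclic V (\<lambda>u v. (u, v) \<in> dart_rel p B)"
  unfolding sg_acyclic_def
proof (intro notI, elim exE conjE)
  fix xs assume len: "3 \<le> length xs" and dist: "distinct xs"
    and cyc: "\<forall>i<length xs. (xs ! i, xs ! ((i + 1) mod length xs)) \<in> dart_rel p B"
  obtain l where l: "length xs = Suc l" "2 \<le> l" using len by (cases "length xs") auto
  have step: "(xs ! i, xs ! Suc i) \<in> dart_rel p B" if "i < l" for i
    using cyc[rule_format, of i] that l(1) by simp
  have "(xs ! l, xs ! 0) \<in> dart_rel p B" using cyc[rule_format, of l] l(1) by simp
  then obtain d where d: "d \<in> B" "p d = xs ! l" "p (\<alpha> d) = xs ! 0" by (auto simp: dart_rel_def)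
  obtain Q where const: "\<And>x. x \<in> B - {d, \<alpha> d} \<Longrightarrow> Q (p x) \<longleftrightarrow> Q (p (\<alpha> x))"
    and Q: "Q (p d)" "\<not> Q (p (\<alpha> d))"
    using all_bridgesE[OF assms d(1)] by blast
  have "\<not> Q (xs ! i)" if "i \<le> l" for i
    using that
  proof (induction i)
    case 0
    then show ?case using Q(2) d(3) by simp
  next
    case (Suc i)
    obtain x where x: "x \<in> B" "p x = xs ! i" "p (\<alpha> x) = xs ! Suc i"
      using step[of i] Suc.prems by (auto simp: dart_rel_def)
    have "x \<noteq> d"
      using x(2) d(2) nth_eq_iff_index_eq[OF dist, of i l] l(1) Suc.prems by auto
    moreover have "x \<noteq> \<alpha> d"
    proof
      assume "x = \<alpha> d"
      then have "xs ! i = xs ! 0" "xs ! Suc i = xs ! l" using x d by simp_all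
      then have "i = 0" "Suc i = l"
        using nth_eq_iff_index_eq[OF dist] l(1) Suc.prems by simp_all
      then show False using l(2) by simp
    qed
    ultimately show ?case using const[of x] x Suc by simp
  qed
  then show False using Q(1) d(2) by simp
qed

lemma sg_acyclic_imp_all_bridges:
  assumes B: "inv_closed B" "p ` B \<subseteq> V" and inj: "inj_on (\<lambda>d. (p d, p (\<alpha> d))) B"
    and no_loop: "\<And>d. d \<in> B \<Longrightarrow> p (\<alpha> d) \<noteq> p d"
    and acyclic: "sg_acyclic V (\<lambda>u v. (u, v) \<in> dart_rel p B)"
  shows "all_bridges p B"
  unfolding all_bridges_def
proof (intro ballI notI)
  fix d assume d: "d \<in> B" and conn: "dart_connected p (B - {d, \<alpha> d}) {p d, p (\<alpha> d)}"
  let ?r = "\<lambda>u v. (u, v) \<in> dart_rel p (B - {d, \<alpha> d})"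
  have sub: "?r u v \<Longrightarrow> (u, v) \<in> dart_rel p B" for u v by (auto simp: dart_rel_def)
  have "?r\<^sup>*\<^sup>* (p d) (p (\<alpha> d))" using conn by (auto simp: dart_connected_def rtranclp_rtrancl_eq)
  then obtain xs where path: "rtrancl_path ?r (p d) xs (p (\<alpha> d))" and dist: "distinct (p d # xs)"
    by (metis rtranclp_eq_rtrancl_path rtrancl_path_distinct)
  have "xs \<noteq> []" using path no_loop[OF d] by (auto elim: rtrancl_path.cases)
  note last = rtrancl_path_last[OF path this]
  have "length xs \<noteq> 1"
  proof
    assume "length xs = 1"
    then have "?r (p d) (p (\<alpha> d))" using rtrancl_path_nth[OF path, of 0] last by (cases xs) auto
    then show False using inj_onD[OF inj, of _ d] d by (fastforce simp: dart_rel_def)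
  qed
  then have len: "3 \<le> length (p d # xs)"
    using \<open>xs \<noteq> []\<close> by (cases xs rule: list.exhaust) (auto simp: Suc_le_eq)
  have cyc: "((p d # xs) ! i, (p d # xs) ! ((i + 1) mod length (p d # xs))) \<in> dart_rel p B"
    if i: "i < length (p d # xs)" for i
  proof (cases "i < length xs")
    case True
    then show ?thesis using sub[OF rtrancl_path_nth[OF path True]] by simp
  next
    case False
    then have "i = length xs" using i by simp
    moreover have "(p (\<alpha> d), p d) \<in> dart_rel p B" using B(1) dart_relI[OF d] by (rule dart_rel_sym)
    ultimately show ?thesis using last \<open>xs \<noteq> []\<close> by (simp add: last_conv_nth nth_Cons')
  qed
  have "set (p d # xs) \<subseteq> V"
  proof
    fix u assume "u \<in> set (p d # xs)"
    then obtain i where "i < length (p d # xs)" "u = (p d # xs) ! i" by (metis in_set_conv_nth)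
    from cyc[OF this(1)] this(2) show "u \<in> V" using B(2) by (auto simp: dart_rel_def)
  qed
  then show False using acyclic dist cyc len unfolding sg_acyclic_def by blast
qed

lemma sg_connected_iff_dart_connected:
  assumes "inv_closed B" "p ` B \<subseteq> V"
  shows "sg_connected V (\<lambda>u v. (u, v) \<in> dart_rel p B) \<longleftrightarrow> dart_connected p B V"
proof -
  have "p (\<alpha> d) \<in> V" if "d \<in> B" for d using that assms inv_closedD[OF assms(1)] by blast
  then have "{(u, v). u \<in> V \<and> v \<in> V \<and> (u, v) \<in> dart_rel p B} = dart_rel p B"
    using assms(2) by (auto simp: dart_rel_def)
  then show ?thesis by (simp add: sg_connected_def dart_connected_def)
qed

lemma sg_tree_iff_dart_tree:
  assumes "inv_closed B" "p ` B \<subseteq> V" "V \<noteq> {}" "inj_on (\<lambda>d. (p d, p (\<alpha> d))) B"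
    and "\<And>d. d \<in> B \<Longrightarrow> p (\<alpha> d) \<noteq> p d"
  shows "sg_tree V (\<lambda>u v. (u, v) \<in> dart_rel p B) \<longleftrightarrow> dart_tree p B V"
proof -
  have "sg_acyclic V (\<lambda>u v. (u, v) \<in> dart_rel p B) \<longleftrightarrow> all_bridges p B"
    using all_bridges_imp_sg_acyclic[OF assms(1)] sg_acyclic_imp_all_bridges[OF assms(1,2,4,5)]
    by blast
  then show ?thesis
    using assms(3) sg_connected_iff_dart_connected[OF assms(1,2)]
    by (simp add: sg_tree_def dart_tree_def)
qed

end

lemma sg_connected_image:
  assumes "sg_connected W adj" "\<And>x y. x \<in> W \<Longrightarrow> y \<in> W \<Longrightarrow> adj x y \<Longrightarrow> adj' (f x) (f y)"
  shows "sg_connected (f ` W) adj'"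
proof -
  let ?R = "{(x, y). x \<in> W \<and> y \<in> W \<and> adj x y}" and ?S = "{(x, y). x \<in> f ` W \<and> y \<in> f ` W \<and> adj' x y}"
  have "(f x, f y) \<in> ?S\<^sup>*" if "(x, y) \<in> ?R\<^sup>*" for x y
    using that
  proof (induction rule: rtrancl_induct)
    case (step y z)
    then have "(f y, f z) \<in> ?S" using assms(2) by blast
    with step.IH show ?case by (rule rtrancl_into_rtrancl)
  qed simp
  then show ?thesis using assms(1) by (auto simp: sg_connected_def)
qed

lemma sg_acyclic_of_image:
  assumes "sg_acyclic (f ` W) adj'" "inj_on f W"
    and adj: "\<And>x y. x \<in> W \<Longrightarrow> y \<in> W \<Longrightarrow> adj x y \<Longrightarrow> adj' (f x) (f y)"
  shows "sg_acyclic W adj"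
  unfolding sg_acyclic_def
proof (intro notI, elim exE conjE)
  fix xs assume xs: "3 \<le> length xs" "distinct xs" "set xs \<subseteq> W"
    and cyc: "\<forall>i<length xs. adj (xs ! i) (xs ! ((i + 1) mod length xs))"
  have next_less: "(i + 1) mod length xs < length xs" for i
    using xs(1) by (intro mod_less_divisor) linarith
  have "adj' (map f xs ! i) (map f xs ! ((i + 1) mod length (map f xs)))"
    if "i < length (map f xs)" for i
    using that cyc xs(3) next_less[of i] by (auto intro!: adj)
  moreover have "distinct (map f xs)"
    using xs(2,3) assms(2) by (simp add: distinct_map inj_on_subset)
  moreover have "set (map f xs) \<subseteq> f ` W" "3 \<le> length (map f xs)" using xs by auto
  ultimately show False using assms(1) unfolding sg_acyclic_def by blast
qed

lemma sg_tree_image_iff: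
  assumes "inj_on f W" "\<And>x y. x \<in> W \<Longrightarrow> y \<in> W \<Longrightarrow> adj' (f x) (f y) \<longleftrightarrow> adj x y"
  shows "sg_tree (f ` W) adj' \<longleftrightarrow> sg_tree W adj"
proof -
  let ?g = "inv_into W f"
  have inverse: "adj (?g x) (?g y)" if "x \<in> f ` W" "y \<in> f ` W" "adj' x y" for x y
    using that assms by auto
  have image: "?g ` f ` W = W" using assms(1) by simp
  have "sg_connected W adj" if "sg_connected (f ` W) adj'"
    using sg_connected_image[OF that, of adj ?g] inverse unfolding image by simp
  moreover have "sg_connected (f ` W) adj'" if "sg_connected W adj"
    using that by (rule sg_connected_image) (simp add: assms(2))
  moreover have "sg_acyclic W adj" if "sg_acyclic (f ` W) adj'"
    using that assms(1) by (rule sg_acyclic_of_image) (simp add: assms(2))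
  moreover have "sg_acyclic (f ` W) adj'" if "sg_acyclic W adj"
    using that inj_on_inv_into[of "f ` W" f W] inverse
    by (intro sg_acyclic_of_image[of ?g "f ` W" adj]) (simp_all only: image)
  ultimately show ?thesis by (auto simp: sg_tree_def)
qed

section \<open>Combinatorial maps\<close>

locale combinatorial_map =
  fixes D :: "'d set" and \<alpha> \<sigma> :: "'d \<Rightarrow> 'd"
  assumes comb_map: "comb_map D \<alpha> \<sigma>"
begin

abbreviation vert :: "'d \<Rightarrow> 'd set" where "vert \<equiv> vertex_of \<sigma>"
abbreviation face :: "'d \<Rightarrow> 'd set" where "face \<equiv> face_of \<alpha> \<sigma>"
abbreviation verts :: "'d set set" where "verts \<equiv> map_verts D \<sigma>"
abbreviation faces :: "'d set set" where "faces \<equiv> map_faces D \<alpha> \<sigma>"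

sublocale dart_involution D \<alpha>
  using comb_map by unfold_locales (auto simp: comb_map_def)

lemma rot_permutes: "\<sigma> permutes D" and darts_nonempty: "D \<noteq> {}"
  using comb_map by (auto simp: comb_map_def)

lemma rot_in_iff [simp]: "\<sigma> d \<in> D \<longleftrightarrow> d \<in> D"
  using rot_permutes by (simp add: permutes_in_image)

lemma rot_eq_iff [simp]: "\<sigma> x = \<sigma> y \<longleftrightarrow> x = y"
  using permutes_inj[OF rot_permutes] by (auto dest: injD)

lemma dual_comb_map: "comb_map D \<alpha> (\<sigma> \<circ> \<alpha>)"
  using comb_map permutes_compose[OF inv_permutes rot_permutes] by (simp add: comb_map_def)

lemma vertex_of_dual: "vertex_of (\<sigma> \<circ> \<alpha>) = face"
  by (simp add: fun_eq_iff vertex_of_def face_of_def)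

lemma permutation_rot: "permutation \<sigma>"
  using finite_darts rot_permutes by (auto simp: permutation_permutes)

lemma vert_self: "d \<in> vert d"
  unfolding vertex_of_def using permutation_rot by (rule permutation_self_in_orbit)

lemma vert_rot [simp]: "vert (\<sigma> d) = vert d"
  unfolding vertex_of_def using permutation_rot by (rule permutation_orbit_step)

lemma in_vert_iff: "x \<in> vert d \<longleftrightarrow> vert x = vert d"
  unfolding vertex_of_def
  using orbit_cyclic_eq3[OF cyclic_on_orbit'[OF permutation_rot]]
    permutation_self_in_orbit[OF permutation_rot]
  by metis

lemma vert_eq_imp_in: "vert x = vert d \<Longrightarrow> d \<in> D \<Longrightarrow> x \<in> D"
  using permutes_orbit_subset[OF rot_permutes, of d] vert_self[of x] by (auto simp: vertex_of_def)

lemma even_card_vert_changes: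
  fixes P :: "'d \<Rightarrow> bool" shows "even (card {x\<in>vert d. P x \<noteq> P (\<sigma> x)})"
  unfolding vertex_of_def using permutation_rot by (rule even_card_orbit_changes)

lemma vert_in_iff [simp]: "vert d \<in> verts \<longleftrightarrow> d \<in> D"
  using vert_eq_imp_in by (auto simp: map_verts_def)

lemma finite_verts: "finite verts"
  using finite_darts by (simp add: map_verts_def)

lemma in_verts_iff: "v \<in> verts \<Longrightarrow> x \<in> v \<longleftrightarrow> vert x = v"
  using in_vert_iff by (metis imageE map_verts_def)

lemma vertsE:
  assumes "v \<in> verts" obtains d where "d \<in> D" "vert d = v"
  using assms by (auto simp: map_verts_def)

lemma card_Un_at_vert:
  assumes "bij_betw vert A verts" "bij_betw vert B verts" "A \<inter> B = {}" "d \<in> D"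
  shows "card {x\<in>A \<union> B. vert x = vert d} = 2"
proof -
  have single: "\<exists>x. {z\<in>R. vert z = vert d} = {x}" if bij: "bij_betw vert R verts" for R
  proof -
    have "vert d \<in> vert ` R" using bij assms(4) by (simp add: bij_betw_def)
    then obtain x where "x \<in> R" "vert x = vert d" by auto
    then have "{z\<in>R. vert z = vert d} = {x}"
      using bij_betw_imp_inj_on[OF bij] by (auto dest: inj_onD)
    then show ?thesis by blast
  qed
  obtain x where x: "{z\<in>A. vert z = vert d} = {x}" using single[OF assms(1)] ..
  obtain y where y: "{z\<in>B. vert z = vert d} = {y}" using single[OF assms(2)] ..
  have "{z\<in>A \<union> B. vert z = vert d} = {x, y}" using x y by blast
  moreover have "x \<noteq> y" using x y assms(3) by blast
  ultimately show ?thesis by simp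
qed

lemma face_self: "d \<in> face d"
  and face_step [simp]: "face (\<sigma> (\<alpha> d)) = face d"
  and in_face_iff: "x \<in> face d \<longleftrightarrow> face x = face d"
  and face_eq_imp_in: "face x = face d \<Longrightarrow> d \<in> D \<Longrightarrow> x \<in> D"
  and face_in_iff [simp]: "face d \<in> faces \<longleftrightarrow> d \<in> D"
  and finite_faces: "finite faces"
  and in_faces_iff: "F \<in> faces \<Longrightarrow> x \<in> F \<longleftrightarrow> face x = F"
proof -
  interpret dual: combinatorial_map D \<alpha> "\<sigma> \<circ> \<alpha>" by unfold_locales (rule dual_comb_map)
  have dual_verts: "map_verts D (\<sigma> \<circ> \<alpha>) = faces"
    by (simp add: map_verts_def map_faces_def vertex_of_dual)
  note dual_simps = vertex_of_dual dual_verts comp_apply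
  show "d \<in> face d" using dual.vert_self by (simp only: dual_simps)
  show "face (\<sigma> (\<alpha> d)) = face d" using dual.vert_rot[of d] by (simp only: dual_simps)
  show "x \<in> face d \<longleftrightarrow> face x = face d" using dual.in_vert_iff by (simp only: dual_simps)
  show "x \<in> D" if "face x = face d" "d \<in> D"
    using that dual.vert_eq_imp_in by (simp only: dual_simps)
  show "face d \<in> faces \<longleftrightarrow> d \<in> D" using dual.vert_in_iff by (simp only: dual_simps)
  show "finite faces" using dual.finite_verts by (simp only: dual_simps)
  show "x \<in> F \<longleftrightarrow> face x = F" if "F \<in> faces" using that dual.in_verts_iff by (simp only: dual_simps)
qed

lemma face_inv [simp]: "face (\<alpha> d) = face (\<sigma> d)"
  using face_step[of "\<alpha> d"] by simp

lemma face_invariant: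
  assumes "\<And>z. face z = face x \<Longrightarrow> P (\<sigma> (\<alpha> z)) \<longleftrightarrow> P z" "face y = face x"
  shows "P y \<longleftrightarrow> P x"
proof -
  have "y \<in> orbit (\<sigma> \<circ> \<alpha>) x" using assms(2) in_face_iff by (simp add: face_of_def)
  then show ?thesis
  proof induction
    case base
    show ?case using assms(1)[of x] by simp
  next
    case (step z)
    then have "face z = face x" using in_face_iff by (simp add: face_of_def)
    from assms(1)[OF this] step.IH show ?case by simp
  qed
qed

lemma facesE:
  assumes "F \<in> faces" obtains d where "d \<in> D" "face d = F"
  using assms by (auto simp: map_faces_def)

text \<open>The edges separating a set of faces from its complement form an even subgraph, and a forest
  contains no nonempty even subgraph.\<close>
lemma no_face_cut_in_vert_forest:
  assumes "inv_closed B" "all_bridges vert B"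
    and P: "\<And>x. P (\<sigma> (\<alpha> x)) \<longleftrightarrow> P x"
    and cut: "\<And>x. x \<in> D \<Longrightarrow> vert x \<in> vert ` B \<Longrightarrow> P x \<noteq> P (\<alpha> x) \<Longrightarrow> x \<in> B"
    and "d \<in> B"
  shows "P (\<alpha> d) \<longleftrightarrow> P d"
proof -
  have P': "P (\<alpha> x) \<longleftrightarrow> P (\<sigma> x)" for x using P[of "\<alpha> x"] by simp
  let ?N = "{x\<in>B. P x \<noteq> P (\<alpha> x)}"
  have "?N = {}"
  proof (rule even_subset_of_bridges_empty[OF assms(1,2)])
    show "inv_closed ?N" using assms(1) by (auto simp: inv_closed_def)
    fix v assume "v \<in> vert ` ?N"
    then obtain e where e: "e \<in> B" "v = vert e" by auto
    then have "e \<in> D" using inv_closed_subset[OF assms(1)] by auto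
    then have "{x\<in>?N. vert x = v} = {x\<in>vert e. P x \<noteq> P (\<sigma> x)}"
      using e cut vert_eq_imp_in by (auto simp: in_vert_iff P')
    then show "even (card {x\<in>?N. vert x = v})" using even_card_vert_changes[of e P] by simp
  qed auto
  then show ?thesis using \<open>d \<in> B\<close> by auto
qed

lemma no_vert_cut_in_face_forest:
  assumes "inv_closed B" "all_bridges face B"
    and P: "\<And>x. P (\<sigma> x) \<longleftrightarrow> P x"
    and cut: "\<And>x. x \<in> D \<Longrightarrow> face x \<in> face ` B \<Longrightarrow> P x \<noteq> P (\<alpha> x) \<Longrightarrow> x \<in> B"
    and "d \<in> B"
  shows "P (\<alpha> d) \<longleftrightarrow> P d"
proof -
  interpret dual: combinatorial_map D \<alpha> "\<sigma> \<circ> \<alpha>" by unfold_locales (rule dual_comb_map)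
  show ?thesis
    by (rule dual.no_face_cut_in_vert_forest[where B = B]) (simp_all add: assms vertex_of_dual)
qed

lemma three_connected_vertex_cover_of_cut:
  assumes "map_3_connected D \<alpha> \<sigma>" "S \<subseteq> verts" "card S \<le> 2"
    and cover: "\<And>z. z \<in> D \<Longrightarrow> vert z \<in> U \<Longrightarrow> vert (\<alpha> z) \<notin> U \<Longrightarrow> vert z \<in> S \<or> vert (\<alpha> z) \<in> S"
  shows "verts \<inter> U \<subseteq> S \<or> verts - U \<subseteq> S"
proof (rule ccontr)
  assume "\<not> (verts \<inter> U \<subseteq> S \<or> verts - U \<subseteq> S)"
  then obtain a b where ab: "a \<in> verts - S" "a \<in> U" "b \<in> verts - S" "b \<notin> U" by blast
  have "sg_connected (verts - S) (map_vadj \<alpha> \<sigma>)"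
    using assms(1-3) by (simp add: map_3_connected_def)
  then have "(a, b) \<in> {(u, w). u \<in> verts - S \<and> w \<in> verts - S \<and> map_vadj \<alpha> \<sigma> u w}\<^sup>*"
    using ab(1,3) by (simp add: sg_connected_def)
  then have "b \<in> U"
  proof (induction rule: rtrancl_induct)
    case (step u w)
    then obtain z where z: "z \<in> u" "vert (\<alpha> z) = w" "u \<in> verts - S" "w \<in> verts - S"
      by (auto simp: map_vadj_def)
    then have "z \<in> D" "vert z = u" using in_verts_iff by auto
    then show ?case using cover[of z] step.IH z by blast
  qed (rule ab(2))
  then show False using ab(4) by blast
qed

lemma ends_of_crossing_edge:
  assumes "e \<in> D" "U \<noteq> {}" "verts - U \<noteq> {}"
  obtains x y where "x \<in> U" "y \<in> verts - U"
    "\<And>z. z = e \<or> z = \<alpha> e \<Longrightarrow> vert z \<in> U \<Longrightarrow> vert (\<alpha> z) \<notin> U \<Longrightarrow> vert z = x \<and> vert (\<alpha> z) = y"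
proof (cases "vert e \<in> U \<longleftrightarrow> vert (\<alpha> e) \<in> U")
  case True
  obtain x y where "x \<in> U" "y \<in> verts - U" using assms(2,3) by blast
  then show thesis by (rule that) (use True in auto)
next
  case False
  then consider (leaving) "vert e \<in> U" "vert (\<alpha> e) \<notin> U" | (entering) "vert (\<alpha> e) \<in> U" "vert e \<notin> U"
    by blast
  then show thesis
  proof cases
    case leaving
    then show thesis using assms(1) by (intro that[of "vert e" "vert (\<alpha> e)"]) auto
  next
    case entering
    then show thesis using assms(1) by (intro that[of "vert (\<alpha> e)" "vert e"]) auto
  qed
qed

text \<open>Whitney: if at most two edges cross a cut, some choice of one end of each of them leaves a
  vertex on both sides, because there are at least four vertices.\<close>
lemma three_connected_delete_two_edges:
  assumes conn3: "map_3_connected D \<alpha> \<sigma>" and d: "d \<in> D" "d' \<in> D"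
  shows "dart_connected vert (D - {d, \<alpha> d, d', \<alpha> d'}) verts"
proof (rule dart_connectedI[OF inv_closed_delete_two_edges[OF d]])
  fix Q u v
  assume const: "\<And>x. x \<in> D - {d, \<alpha> d, d', \<alpha> d'} \<Longrightarrow> Q (vert x) \<longleftrightarrow> Q (vert (\<alpha> x))"
    and uv: "u \<in> verts" "v \<in> verts" "Q u"
  show "Q v"
  proof (rule ccontr)
    assume "\<not> Q v"
    define U where "U = {w\<in>verts. Q w}"
    have ne: "U \<noteq> {}" "verts - U \<noteq> {}" using uv \<open>\<not> Q v\<close> by (auto simp: U_def)
    obtain x y where xy: "x \<in> U" "y \<in> verts - U" and xy_ends:
      "\<And>z. z = d \<or> z = \<alpha> d \<Longrightarrow> vert z \<in> U \<Longrightarrow> vert (\<alpha> z) \<notin> U \<Longrightarrow> vert z = x \<and> vert (\<alpha> z) = y"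
      by (rule ends_of_crossing_edge[OF d(1) ne]) blast
    obtain x' y' where xy': "x' \<in> U" "y' \<in> verts - U" and xy'_ends:
      "\<And>z. z = d' \<or> z = \<alpha> d' \<Longrightarrow> vert z \<in> U \<Longrightarrow> vert (\<alpha> z) \<notin> U \<Longrightarrow> vert z = x' \<and> vert (\<alpha> z) = y'"
      by (rule ends_of_crossing_edge[OF d(2) ne]) blast
    have covered: "U \<subseteq> {p, q} \<or> verts - U \<subseteq> {p, q}" if "p \<in> {x, y}" "q \<in> {x', y'}" for p q
    proof -
      have "{p, q} \<subseteq> verts" "card {p, q} \<le> 2" using that xy xy' by (auto simp: U_def card_insert_if)
      moreover have "vert z \<in> {p, q} \<or> vert (\<alpha> z) \<in> {p, q}"
        if z: "z \<in> D" "vert z \<in> U" "vert (\<alpha> z) \<notin> U" for z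
      proof -
        have "z \<in> {d, \<alpha> d, d', \<alpha> d'}" using const[of z] z by (auto simp: U_def)
        then show ?thesis
          using xy_ends[OF _ z(2,3)] xy'_ends[OF _ z(2,3)] \<open>p \<in> {x, y}\<close> \<open>q \<in> {x', y'}\<close> by blast
      qed
      moreover have "verts \<inter> U = U" by (auto simp: U_def)
      ultimately show ?thesis
        using three_connected_vertex_cover_of_cut[OF conn3, of "{p, q}" U] by simp
    qed
    have "U \<subseteq> {x, x'}" "verts - U \<subseteq> {y, y'}" "U \<subseteq> {x} \<or> verts - U \<subseteq> {y'}"
      using covered[of x x'] covered[of y y'] covered[of x y'] xy xy' by blast+
    then have "card U \<le> card {x, x'}" "card (verts - U) \<le> card {y, y'}"
      "card U \<le> card {x} \<or> card (verts - U) \<le> card {y'}"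
      by (meson card_mono finite.emptyI finite.insertI)+
    then have "card U + card (verts - U) \<le> 3" by (auto simp: card_insert_if split: if_splits)
    moreover have "card (verts - U) = card verts - card U" "card U \<le> card verts"
      using finite_verts by (auto simp: U_def card_Diff_subset intro: card_mono)
    ultimately show False using conn3 by (simp add: map_3_connected_def)
  qed
qed

end

locale plane_combinatorial_map =
  fixes D :: "'d set" and \<alpha> \<sigma> :: "'d \<Rightarrow> 'd"
  assumes plane_map: "plane_map D \<alpha> \<sigma>"
begin

sublocale combinatorial_map D \<alpha> \<sigma>
  using plane_map by unfold_locales (simp add: plane_map_def)

lemma euler: "2 * card verts + 2 * card faces = card D + 4"
proof -
  have "card D = 2 * card (map_edges D \<alpha>)"
    unfolding map_edges_def using inv_closed_darts by (rule card_eq_twice_card_edges)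
  then show ?thesis using plane_map by (auto simp: plane_map_def)
qed

lemma connected_invariant:
  assumes "\<And>x. x \<in> D \<Longrightarrow> P (\<alpha> x) \<longleftrightarrow> P x" "\<And>x. x \<in> D \<Longrightarrow> P (\<sigma> x) \<longleftrightarrow> P x" "d \<in> D" "d' \<in> D"
  shows "P d \<longleftrightarrow> P d'"
proof -
  have "(d, d') \<in> {(x, y). x \<in> D \<and> (y = \<alpha> x \<or> y = \<sigma> x)}\<^sup>*"
    using plane_map assms(3,4) by (auto simp: plane_map_def map_connected_def)
  then show ?thesis by (induction rule: rtrancl_induct) (use assms in auto)
qed

lemma cotree_connected:
  assumes "inv_closed B" "all_bridges vert B"
  shows "dart_connected face (D - B) faces"
proof (rule dart_connectedI)
  show "inv_closed (D - B)" using inv_closed_darts assms(1) by (rule inv_closed_Diff)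
  fix Q u v assume const: "\<And>x. x \<in> D - B \<Longrightarrow> Q (face x) \<longleftrightarrow> Q (face (\<alpha> x))"
    and uv: "u \<in> faces" "v \<in> faces" "Q u"
  have inv: "Q (face (\<alpha> x)) \<longleftrightarrow> Q (face x)" if "x \<in> D" for x
  proof (cases "x \<in> B")
    case True
    show ?thesis
    proof (rule no_face_cut_in_vert_forest[OF assms, of "\<lambda>x. Q (face x)"])
      show "y \<in> B" if "y \<in> D" "Q (face y) \<noteq> Q (face (\<alpha> y))" for y
        using const[of y] that by blast
    qed (use True in simp_all)
  next
    case False
    then show ?thesis using const[of x] that by blast
  qed
  then have rot: "Q (face (\<sigma> x)) \<longleftrightarrow> Q (face x)" if "x \<in> D" for x using that by simp
  obtain x y where xy: "x \<in> D" "face x = u" "y \<in> D" "face y = v" using uv(1,2) by (elim facesE)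
  have "Q (face x) \<longleftrightarrow> Q (face y)"
    using inv rot xy(1,3) by (rule connected_invariant[of "\<lambda>x. Q (face x)"])
  then show "Q v" using uv(3) xy(2,4) by simp
qed

text \<open>A spanning tree avoiding two edges with the same two faces would leave a connected dual graph
  in which one of them could still be deleted, against Euler's formula.\<close>
lemma double_dual_edge_disconnects:
  assumes d: "d \<in> D" "d' \<in> D" "d' \<noteq> d" "d' \<noteq> \<alpha> d" "face d' = face d" "face (\<alpha> d') = face (\<alpha> d)"
  shows "\<not> dart_connected vert (D - {d, \<alpha> d, d', \<alpha> d'}) verts"
proof
  let ?G = "D - {d, \<alpha> d, d', \<alpha> d'}"
  assume conn: "dart_connected vert ?G verts"
  have "inv_closed ?G" using d(1,2) by (rule inv_closed_delete_two_edges)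
  from ex_dart_tree[OF this conn] obtain A
    where A: "A \<subseteq> ?G" "inv_closed A" "dart_connected vert A verts" "all_bridges vert A"
    by (auto simp: dart_tree_def)
  let ?C = "D - A"
  have C: "inv_closed ?C" using inv_closed_darts A(2) by (rule inv_closed_Diff)
  have dC: "d \<in> ?C" "d' \<in> ?C" using A(1) d(1,2) by auto
  have "dart_connected face (?C - {d, \<alpha> d}) {face d, face (\<alpha> d)}"
  proof (rule dart_connectedI[OF inv_closed_delete_edge[OF C dC(1)]])
    fix Q u v assume const: "\<And>x. x \<in> ?C - {d, \<alpha> d} \<Longrightarrow> Q (face x) \<longleftrightarrow> Q (face (\<alpha> x))"
      and uv: "u \<in> {face d, face (\<alpha> d)}" "v \<in> {face d, face (\<alpha> d)}" "Q u"
    have "Q (face d) \<longleftrightarrow> Q (face (\<alpha> d))" using const[of d'] dC d(3-6) by simp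
    with uv show "Q v" by blast
  qed
  with cotree_connected[OF A(2,4)] have "dart_connected face (?C - {d, \<alpha> d}) faces"
    using dart_connected_delete_edge[OF C dC(1)] by blast
  then have "2 * card faces \<le> card (?C - {d, \<alpha> d}) + 2"
    using inv_closed_delete_edge[OF C dC(1)] finite_faces
    by (intro dart_connected_card[of _ face]) auto
  moreover have "2 * card verts \<le> card A + 2"
    using A finite_verts by (intro dart_connected_card[of _ vert]) auto
  moreover have "card D = card A + (2 + card (?C - {d, \<alpha> d}))"
  proof -
    have "D \<inter> A = A" "?C \<inter> {d, \<alpha> d} = {d, \<alpha> d}"
      using inv_closed_subset[OF A(2)] dC(1) inv_closedD[OF C] by auto
    then show ?thesis
      using card_Int_Diff[OF finite_darts, of A] card_Int_Diff[of ?C "{d, \<alpha> d}"] finite_darts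
        inv_neq[OF d(1)] by simp
  qed
  ultimately show False using euler by linarith
qed

end

section \<open>Face-coloured cubic maps\<close>

locale coloured_cubic_map = plane_combinatorial_map D \<alpha> \<sigma>
  for D :: "'d set" and \<alpha> \<sigma> :: "'d \<Rightarrow> 'd" +
  fixes col :: "'d set \<Rightarrow> nat"
  assumes cubic: "map_cubic D \<sigma>"
    and coloring: "proper_face_3_coloring D \<alpha> \<sigma> col"
begin

lemma colours_distinct:
  fixes a b c :: nat assumes "{a, b, c} = {1, 2, 3}" shows "a \<noteq> b" "a \<noteq> c" "b \<noteq> c"
proof -
  have "card {a, b, c} = 3" unfolding assms by simp
  then show "a \<noteq> b" "a \<noteq> c" "b \<noteq> c" by (auto simp: card_insert_if split: if_splits)
qed

abbreviation dcol :: "'d \<Rightarrow> nat" where "dcol d \<equiv> col (face d)"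

lemma cubic_rotation:
  assumes "d \<in> D"
  shows "vert d = {d, \<sigma> d, \<sigma> (\<sigma> d)}" "\<sigma> d \<noteq> d" "\<sigma> (\<sigma> d) \<noteq> d" "\<sigma> (\<sigma> (\<sigma> d)) = d"
proof -
  let ?n = "funpow_dist1 \<sigma> d d"
  have self: "d \<in> orbit \<sigma> d" using permutation_rot by (rule permutation_self_in_orbit)
  have inj: "inj_on (\<lambda>i. (\<sigma> ^^ i) d) {0..<?n}" using self by (rule inj_on_funpow_dist1)
  have vert: "vert d = (\<lambda>i. (\<sigma> ^^ i) d) ` {0..<?n}"
    unfolding vertex_of_def using self by (rule orbit_conv_funpow_dist1)
  have "card (vert d) = 3" using cubic assms by (simp add: map_cubic_def)
  then have n: "?n = 3" using card_image[OF inj] unfolding vert by simp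
  then have interval: "{0..<?n} = {0, 1, 2}" by auto
  show "vert d = {d, \<sigma> d, \<sigma> (\<sigma> d)}" unfolding vert interval by (simp add: numeral_2_eq_2)
  show "\<sigma> d \<noteq> d" "\<sigma> (\<sigma> d) \<noteq> d"
    using inj unfolding interval by (auto simp: inj_on_def numeral_2_eq_2)
  show "\<sigma> (\<sigma> (\<sigma> d)) = d" using funpow_dist1_prop[OF self] n by (simp add: numeral_3_eq_3)
qed

lemma rot_cubed [simp]: "\<sigma> (\<sigma> (\<sigma> d)) = d"
  using cubic_rotation(4) rot_permutes by (cases "d \<in> D") (auto simp: permutes_not_in)

lemma vert_eqE:
  assumes "vert y = vert x" "x \<in> D"
  obtains "y = x" | "y = \<sigma> x" | "y = \<sigma> (\<sigma> x)"
  using assms cubic_rotation(1)[of x] in_vert_iff[of y x] by auto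

lemma card_darts: "card D = 3 * card verts"
  unfolding map_verts_def
proof (rule card_eq_mult_card_image[OF finite_darts])
  fix x assume "x \<in> D"
  then have "{y\<in>D. vert y = vert x} = vert x" using vert_eq_imp_in by (fastforce simp: in_vert_iff)
  then show "card {y\<in>D. vert y = vert x} = 3"
    using cubic \<open>x \<in> D\<close> by (simp add: map_cubic_def)
qed

lemma dcol_in: "d \<in> D \<Longrightarrow> dcol d \<in> {1, 2, 3}"
  using coloring face_in_iff unfolding proper_face_3_coloring_def by blast

lemma dcol_inv_neq: "d \<in> D \<Longrightarrow> dcol (\<alpha> d) \<noteq> dcol d"
  using coloring unfolding proper_face_3_coloring_def by metis

lemma dcol_rot_neq:
  assumes "d \<in> D"
  shows "dcol (\<sigma> d) \<noteq> dcol d" "dcol (\<sigma> (\<sigma> d)) \<noteq> dcol d" "dcol (\<sigma> (\<sigma> d)) \<noteq> dcol (\<sigma> d)"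
  using dcol_inv_neq[of d] dcol_inv_neq[of "\<sigma> d"] dcol_inv_neq[of "\<sigma> (\<sigma> d)"] assms by simp_all

lemma bij_betw_dcol_vert:
  assumes "d \<in> D" shows "bij_betw dcol (vert d) {1, 2, 3}"
proof (rule bij_betw_imageI)
  show inj: "inj_on dcol (vert d)"
    using dcol_rot_neq[OF assms] by (auto simp: inj_on_def cubic_rotation(1)[OF assms])
  have "card (vert d) = 3" using cubic assms by (simp add: map_cubic_def)
  then have "card (dcol ` vert d) = card {1, 2, 3 :: nat}" using card_image[OF inj] by simp
  moreover have "dcol x \<in> {1, 2, 3}" if "x \<in> vert d" for x
    using dcol_in[of x] vert_eq_imp_in[OF _ assms, of x] that in_vert_iff by blast
  then have "dcol ` vert d \<subseteq> {1, 2, 3}" by (rule image_subsetI)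
  ultimately show "dcol ` vert d = {1, 2, 3}" by (intro card_subset_eq) simp_all
qed

lemma vert_colour:
  assumes "d \<in> D" "i \<in> {1, 2, 3}"
  obtains x where "x \<in> D" "vert x = vert d" "dcol x = i"
proof -
  obtain x where "x \<in> vert d" "dcol x = i"
    using bij_betw_dcol_vert[OF assms(1)] assms(2) by (metis bij_betw_imp_surj_on imageE)
  then show thesis using that vert_eq_imp_in[OF _ assms(1), of x] by (simp add: in_vert_iff)
qed

lemma inv_vert_neq:
  assumes "d \<in> D" shows "vert (\<alpha> d) \<noteq> vert d"
proof
  assume "vert (\<alpha> d) = vert d"
  then show False
  proof (rule vert_eqE[OF _ assms])
    assume "\<alpha> d = \<sigma> d"
    then have "face (\<sigma> (\<sigma> d)) = face d" using face_step[of d] by simp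
    then show False using dcol_rot_neq(2)[OF assms] by simp
  next
    assume "\<alpha> d = \<sigma> (\<sigma> d)"
    then have "face (\<sigma> (\<sigma> d)) = face (\<sigma> d)" using face_inv[of d] by simp
    then show False using dcol_rot_neq(3)[OF assms] by simp
  qed (use inv_neq[OF assms] in simp)
qed

section \<open>Regions of faces\<close>

text \<open>A region is a union of faces containing the faces of colour \<open>a\<close> but none of colour \<open>b\<close>; it is
  represented by the set of darts of its faces.\<close>

definition region :: "nat \<Rightarrow> nat \<Rightarrow> 'd set \<Rightarrow> bool" where
  "region a b S \<longleftrightarrow> {a, b} \<subseteq> {1, 2, 3} \<and> S \<subseteq> D \<and> (\<forall>d\<in>S. face d \<subseteq> S) \<and>
     (\<forall>d\<in>D. dcol d = a \<longrightarrow> d \<in> S) \<and> (\<forall>d\<in>S. dcol d \<noteq> b)"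

definition boundary :: "'d set \<Rightarrow> 'd set" where
  "boundary S = {d\<in>D. (d \<in> S) \<noteq> (\<alpha> d \<in> S)}"

definition oriented_boundary :: "'d set \<Rightarrow> 'd set" where
  "oriented_boundary S = {d\<in>S. \<alpha> d \<notin> S}"

definition interior_darts :: "'d set \<Rightarrow> 'd set" where
  "interior_darts S = {d\<in>S. \<alpha> d \<in> S}"

definition ham_region :: "nat \<Rightarrow> nat \<Rightarrow> 'd set \<Rightarrow> bool" where
  "ham_region a b S \<longleftrightarrow> region a b S \<and> dart_connected vert (boundary S) verts"

lemma regionI:
  assumes "{a, b} \<subseteq> {1, 2, 3}" "S \<subseteq> D" and step: "\<And>d. d \<in> D \<Longrightarrow> \<sigma> (\<alpha> d) \<in> S \<longleftrightarrow> d \<in> S"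
    and "\<And>d. d \<in> D \<Longrightarrow> dcol d = a \<Longrightarrow> d \<in> S" "\<And>d. d \<in> S \<Longrightarrow> dcol d \<noteq> b"
  shows "region a b S"
proof -
  have "x \<in> S \<longleftrightarrow> d \<in> S" if "d \<in> D" "face x = face d" for x d
    using _ that(2)
  proof (rule face_invariant[of d "\<lambda>x. x \<in> S"])
    show "\<sigma> (\<alpha> z) \<in> S \<longleftrightarrow> z \<in> S" if "face z = face d" for z
      using step face_eq_imp_in[OF that \<open>d \<in> D\<close>] by blast
  qed
  then have "\<forall>d\<in>S. face d \<subseteq> S" using assms(2) in_face_iff by blast
  then show ?thesis using assms by (simp add: region_def)
qed

lemma region_subset: "region a b S \<Longrightarrow> S \<subseteq> D"
  by (simp add: region_def)

lemma region_face_eq: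
  assumes "region a b S" "face x = face d" shows "x \<in> S \<longleftrightarrow> d \<in> S"
proof -
  have "\<forall>y\<in>S. face y \<subseteq> S" using assms(1) by (simp add: region_def)
  moreover have "x \<in> face d" "d \<in> face x" using assms(2) by (simp_all add: in_face_iff)
  ultimately show ?thesis by blast
qed

lemma region_inv: "region a b S \<Longrightarrow> \<alpha> d \<in> S \<longleftrightarrow> \<sigma> d \<in> S"
  by (rule region_face_eq) simp_all

lemma region_face_step: "region a b S \<Longrightarrow> \<sigma> (\<alpha> d) \<in> S \<longleftrightarrow> d \<in> S"
  by (rule region_face_eq) simp_all

lemma region_complement:
  assumes "region a b S" shows "region b a (D - S)"
  by (rule regionI) (use assms region_face_step[OF assms] in \<open>auto simp: region_def\<close>)

lemma inv_closed_boundary: "inv_closed (boundary S)"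
  by (auto simp: inv_closed_def boundary_def)

lemma boundary_complement: "boundary (D - S) = boundary S"
  by (auto simp: boundary_def)

lemma ham_region_complement: "ham_region a b S \<Longrightarrow> ham_region b a (D - S)"
  by (simp add: ham_region_def region_complement boundary_complement)

lemma inv_closed_interior: "S \<subseteq> D \<Longrightarrow> inv_closed (interior_darts S)"
  by (auto simp: inv_closed_def interior_darts_def)

lemma region_vert:
  assumes "region a b S" "v \<in> verts"
  obtains x y where "x \<in> S" "vert x = v" "y \<in> D - S" "vert y = v"
proof -
  obtain d where d: "d \<in> D" "vert d = v" using assms(2) by (rule vertsE)
  have "a \<in> {1, 2, 3}" "b \<in> {1, 2, 3}" using assms(1) by (simp_all add: region_def)
  then obtain x y where "x \<in> D" "vert x = v" "dcol x = a" "y \<in> D" "vert y = v" "dcol y = b"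
    using vert_colour[OF d(1)] d(2) by metis
  then show thesis using that[of x y] assms(1) by (auto simp: region_def)
qed

lemma bij_betw_vert_oriented_boundary:
  assumes "region a b S" shows "bij_betw vert (oriented_boundary S) verts"
proof (rule bij_betw_imageI)
  have iff: "d \<in> oriented_boundary S \<longleftrightarrow> d \<in> S \<and> \<sigma> d \<notin> S" for d
    using region_inv[OF assms] by (simp add: oriented_boundary_def)
  have SD: "S \<subseteq> D" using assms by (rule region_subset)
  show "inj_on vert (oriented_boundary S)"
  proof (rule inj_onI)
    fix x y assume xy: "x \<in> oriented_boundary S" "y \<in> oriented_boundary S" "vert x = vert y"
    then have "vert y = vert x" "x \<in> D" using SD by (auto simp: iff)
    then show "x = y" by (rule vert_eqE) (use xy in \<open>auto simp: iff\<close>)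
  qed
  show "vert ` oriented_boundary S = verts"
  proof
    show "vert ` oriented_boundary S \<subseteq> verts" using SD by (auto simp: iff)
    show "verts \<subseteq> vert ` oriented_boundary S"
    proof
      fix v assume "v \<in> verts"
      then obtain x y where xy: "x \<in> S" "vert x = v" "y \<notin> S" "vert y = v"
        using region_vert[OF assms] by blast
      then have "vert y = vert x" "x \<in> D" using SD by auto
      then have "\<sigma> x \<notin> S \<or> \<sigma> (\<sigma> x) \<notin> S" by (rule vert_eqE) (use xy in auto)
      then have "x \<in> oriented_boundary S \<or> \<sigma> x \<in> oriented_boundary S"
        using xy(1) by (auto simp: iff)
      then show "v \<in> vert ` oriented_boundary S" using xy(2) vert_rot[of x] by (metis imageI)
    qed
  qed
qed

lemma oriented_boundary_eqI:
  assumes "region a b S" "x \<in> oriented_boundary S" "y \<in> oriented_boundary S" "vert x = vert y"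
  shows "x = y"
  using inj_onD[OF bij_betw_imp_inj_on[OF bij_betw_vert_oriented_boundary[OF assms(1)]]] assms(2-4)
  by blast

lemma boundary_eq_Un:
  "S \<subseteq> D \<Longrightarrow> boundary S = oriented_boundary S \<union> oriented_boundary (D - S)"
  by (auto simp: boundary_def oriented_boundary_def)

lemma card_boundary_at_vert:
  assumes "region a b S" "d \<in> D" shows "card {x\<in>boundary S. vert x = vert d} = 2"
  unfolding boundary_eq_Un[OF region_subset[OF assms(1)]]
proof (rule card_Un_at_vert)
  show "bij_betw vert (oriented_boundary S) verts" "bij_betw vert (oriented_boundary (D - S)) verts"
    using assms(1) region_complement bij_betw_vert_oriented_boundary by blast+
qed (use assms(2) in \<open>auto simp: oriented_boundary_def\<close>)

lemma card_boundary:
  assumes "region a b S" shows "card (boundary S) = 2 * card verts"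
proof -
  have "card (boundary S) = 2 * card (vert ` boundary S)"
    using inv_closed_finite[OF inv_closed_boundary] card_boundary_at_vert[OF assms]
    by (intro card_eq_mult_card_image) (auto simp: boundary_def)
  moreover have "vert ` boundary S = verts"
  proof
    have "oriented_boundary S \<subseteq> boundary S" using boundary_eq_Un region_subset[OF assms] by simp
    then show "verts \<subseteq> vert ` boundary S"
      using bij_betw_imp_surj_on[OF bij_betw_vert_oriented_boundary[OF assms]] by blast
  qed (auto simp: boundary_def)
  ultimately show ?thesis by simp
qed

text \<open>Walking along the boundary, the faces met on one side are consecutively adjacent.\<close>
lemma ham_region_interior_connected:
  assumes "ham_region a b S"
  shows "dart_connected face (interior_darts S) (face ` S)"
proof (rule dart_connectedI)
  have reg: "region a b S" and conn: "dart_connected vert (boundary S) verts"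
    using assms by (auto simp: ham_region_def)
  have SD: "S \<subseteq> D" using reg by (rule region_subset)
  then show "inv_closed (interior_darts S)" by (rule inv_closed_interior)
  fix Q u v
  assume const: "\<And>x. x \<in> interior_darts S \<Longrightarrow> Q (face x) \<longleftrightarrow> Q (face (\<alpha> x))"
    and uv: "u \<in> face ` S" "v \<in> face ` S" "Q u"
  have next_face: "Q (face x) \<longleftrightarrow> Q (face (\<sigma> x))" if "x \<in> S" "\<sigma> x \<in> S" for x
    using const[of x] that region_inv[OF reg, of x] by (simp add: interior_darts_def)
  have same_vert: "Q (face x) \<longleftrightarrow> Q (face y)" if "x \<in> S" "y \<in> S" "vert y = vert x" for x y
    using that(3) subsetD[OF SD that(1)]
  proof (rule vert_eqE)
    assume "y = \<sigma> (\<sigma> x)"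
    then show ?thesis using next_face[of y] that(1,2) by simp
  qed (use next_face[of x] that in auto)
  define R where "R w \<longleftrightarrow> (\<exists>x\<in>S. vert x = w \<and> Q (face x))" for w
  have R_iff: "R (vert x) \<longleftrightarrow> Q (face x)" if "x \<in> S" for x
    using same_vert that unfolding R_def by metis
  have step: "R (vert d) \<longleftrightarrow> R (vert (\<alpha> d))" if "d \<in> boundary S" for d
  proof (cases "d \<in> S")
    case True
    then show ?thesis using R_iff[of d] R_iff[of "\<sigma> (\<alpha> d)"] region_face_step[OF reg, of d] by simp
  next
    case False
    then have "\<alpha> d \<in> S" using that by (simp add: boundary_def)
    then show ?thesis using R_iff[of "\<alpha> d"] R_iff[of "\<sigma> d"] region_inv[OF reg, of d] by simp
  qed
  obtain x y where xy: "x \<in> S" "u = face x" "y \<in> S" "v = face y" using uv(1,2) by blast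
  then have "R (vert x) \<longleftrightarrow> R (vert y)"
    using dart_connectedD[OF conn step, of "vert x" "vert y"] SD by auto
  then show "Q v" using R_iff xy uv(3) by simp
qed

lemma card_interior_darts:
  assumes "region a b S"
  shows "card (interior_darts S) + card (interior_darts (D - S)) = card verts"
proof -
  have fin: "finite (interior_darts S)" "finite (interior_darts (D - S))" "finite (boundary S)"
    using region_subset[OF assms] inv_closed_boundary
    by (auto intro!: inv_closed_finite inv_closed_interior)
  have "D = interior_darts S \<union> interior_darts (D - S) \<union> boundary S"
    using region_subset[OF assms] by (auto simp: interior_darts_def boundary_def)
  then have "card D = card (interior_darts S \<union> interior_darts (D - S) \<union> boundary S)" by simp
  also have "\<dots> = card (interior_darts S \<union> interior_darts (D - S)) + card (boundary S)"
    using fin by (intro card_Un_disjoint) (auto simp: interior_darts_def boundary_def)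
  also have "card (interior_darts S \<union> interior_darts (D - S)) =
      card (interior_darts S) + card (interior_darts (D - S))"
    using fin by (intro card_Un_disjoint) (auto simp: interior_darts_def)
  finally show ?thesis using card_darts card_boundary[OF assms] by simp
qed

lemma card_faces_region:
  assumes "region a b S" shows "card (face ` S) + card (face ` (D - S)) = card faces"
proof -
  have "face x \<noteq> face y" if "x \<in> S" "y \<in> D - S" for x y
    using region_face_eq[OF assms, of x y] that by blast
  then have disjoint: "face ` S \<inter> face ` (D - S) = {}" by blast
  have "faces = face ` S \<union> face ` (D - S)"
    using region_subset[OF assms] by (auto simp: map_faces_def)
  moreover from this have "finite (face ` S)" "finite (face ` (D - S))"
    using finite_faces by simp_all
  ultimately show ?thesis using disjoint by (simp add: card_Un_disjoint)
qed

lemma ham_region_dart_tree: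
  assumes "ham_region a b S" shows "dart_tree face (interior_darts S) (face ` S)"
proof -
  have reg: "region a b S" using assms by (simp add: ham_region_def)
  have SD: "S \<subseteq> D" using reg by (rule region_subset)
  have finS: "finite S" using SD finite_darts by (rule finite_subset)
  have sub: "face ` interior_darts R \<subseteq> face ` R" for R by (auto simp: interior_darts_def)
  have "2 * card (face ` (D - S)) \<le> card (interior_darts (D - S)) + 2"
    using finite_darts ham_region_interior_connected[OF ham_region_complement[OF assms]] sub
    by (intro dart_connected_card[of _ face] inv_closed_interior) auto
  then have "card (interior_darts S) + 2 \<le> 2 * card (face ` S)"
    using card_interior_darts[OF reg] card_faces_region[OF reg] euler card_darts by linarith
  then show ?thesis
    using finS ham_region_interior_connected[OF assms] sub inv_closed_interior[OF SD]
    by (intro dart_tree_if_card_le) auto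
qed

text \<open>A vertex set closed under the boundary is cut only by interior edges, hence by no edge of the
  region at all.\<close>
lemma region_edge_not_cut:
  assumes reg: "region a b S" and "all_bridges face (interior_darts S)"
    and const: "\<And>x. x \<in> boundary S \<Longrightarrow> Q (vert x) \<longleftrightarrow> Q (vert (\<alpha> x))" and "d \<in> S"
  shows "Q (vert (\<alpha> d)) \<longleftrightarrow> Q (vert d)"
proof (cases "d \<in> interior_darts S")
  case True
  have closed: "inv_closed (interior_darts S)"
    using region_subset[OF reg] by (rule inv_closed_interior)
  show ?thesis
  proof (rule no_vert_cut_in_face_forest[OF closed assms(2), of "\<lambda>x. Q (vert x)"])
    fix x assume x: "x \<in> D" "face x \<in> face ` interior_darts S" "Q (vert x) \<noteq> Q (vert (\<alpha> x))"
    then obtain e where "face x = face e" "e \<in> S" by (auto simp: interior_darts_def)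
    then have "x \<in> S" using region_face_eq[OF reg] by blast
    moreover have "x \<notin> boundary S" using const[of x] x(3) by blast
    ultimately show "x \<in> interior_darts S" using x(1) by (simp add: boundary_def interior_darts_def)
  qed (use True in simp_all)
next
  case False
  then have "d \<in> boundary S"
    using \<open>d \<in> S\<close> region_subset[OF reg] by (auto simp: boundary_def interior_darts_def)
  then show ?thesis using const[of d] by blast
qed

lemma region_dart_tree_imp_ham_region:
  assumes reg: "region a b S" and tree: "dart_tree face (interior_darts S) (face ` S)"
  shows "ham_region a b S"
proof -
  have conn: "dart_connected face (interior_darts S) (face ` S)"
    and bridges: "all_bridges face (interior_darts S)" using tree by (auto simp: dart_tree_def)
  have "dart_connected vert (boundary S) verts"
  proof (rule dart_connectedI[OF inv_closed_boundary])
    fix Q u v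
    assume const: "\<And>x. x \<in> boundary S \<Longrightarrow> Q (vert x) \<longleftrightarrow> Q (vert (\<alpha> x))"
      and uv: "u \<in> verts" "v \<in> verts" "Q u"
    note edge = region_edge_not_cut[OF reg bridges, of Q, OF const]
    have same_face: "Q (vert y) \<longleftrightarrow> Q (vert x)" if "x \<in> S" "face y = face x" for x y
      using _ that(2)
    proof (rule face_invariant[of x "\<lambda>x. Q (vert x)"])
      fix z assume "face z = face x"
      then have "z \<in> S" using region_face_eq[OF reg, of z x] that(1) by simp
      then show "Q (vert (\<sigma> (\<alpha> z))) \<longleftrightarrow> Q (vert z)" using edge by simp
    qed
    define R where "R F \<longleftrightarrow> (\<exists>x\<in>S. face x = F \<and> Q (vert x))" for F
    have R_iff: "R (face x) \<longleftrightarrow> Q (vert x)" if "x \<in> S" for x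
      using same_face that unfolding R_def by metis
    have step: "R (face d) \<longleftrightarrow> R (face (\<alpha> d))" if "d \<in> interior_darts S" for d
      using that R_iff[of d] R_iff[of "\<alpha> d"] edge[of d] unfolding interior_darts_def by blast
    obtain x y where xy: "x \<in> S" "vert x = u" "y \<in> S" "vert y = v"
      using uv region_vert[OF reg] by metis
    have "R (face x) \<longleftrightarrow> R (face y)" using conn step by (rule dart_connectedD) (use xy in auto)
    then show "Q v" using R_iff xy uv(3) by simp
  qed
  then show ?thesis using reg by (simp add: ham_region_def)
qed

lemma ham_region_iff_dart_tree:
  assumes "region a b S"
  shows "ham_region a b S \<longleftrightarrow> dart_tree face (interior_darts S) (face ` S)"
  using assms ham_region_dart_tree region_dart_tree_imp_ham_region by blast

section \<open>Hamiltonian cycles\<close>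

lemma card_edges_at_vert:
  assumes "inv_closed B" "d \<in> D"
  shows "card {e\<in>edge_of \<alpha> ` B. e \<inter> vert d \<noteq> {}} = card {x\<in>B. vert x = vert d}"
proof -
  have "{e\<in>edge_of \<alpha> ` B. e \<inter> vert d \<noteq> {}} = edge_of \<alpha> ` {x\<in>B. vert x = vert d}"
  proof (intro equalityI subsetI)
    fix e assume "e \<in> {e\<in>edge_of \<alpha> ` B. e \<inter> vert d \<noteq> {}}"
    then obtain x where x: "x \<in> B" "e = edge_of \<alpha> x" "e \<inter> vert d \<noteq> {}" by blast
    then have "vert x = vert d \<or> vert (\<alpha> x) = vert d" by (auto simp: edge_of_def in_vert_iff)
    moreover have "\<alpha> x \<in> B" "e = edge_of \<alpha> (\<alpha> x)" using x(1,2) inv_closedD[OF assms(1)] by simp_all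
    ultimately show "e \<in> edge_of \<alpha> ` {x\<in>B. vert x = vert d}" using x(1,2) by blast
  next
    fix e assume "e \<in> edge_of \<alpha> ` {x\<in>B. vert x = vert d}"
    then obtain x where x: "x \<in> B" "e = edge_of \<alpha> x" "vert x = vert d" by blast
    then have "x \<in> e \<inter> vert d" by (simp add: edge_of_def in_vert_iff)
    with x(1,2) show "e \<in> {e\<in>edge_of \<alpha> ` B. e \<inter> vert d \<noteq> {}}" by blast
  qed
  moreover have "inj_on (edge_of \<alpha>) {x\<in>B. vert x = vert d}"
  proof (rule inj_onI)
    fix x y
    assume xy: "x \<in> {x\<in>B. vert x = vert d}" "y \<in> {x\<in>B. vert x = vert d}"
      "edge_of \<alpha> x = edge_of \<alpha> y"
    then have "y \<in> D" using inv_closed_subset[OF assms(1)] by blast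
    then show "x = y" using xy inv_vert_neq[of y] by (auto simp: edge_of_eq_iff)
  qed
  ultimately show ?thesis by (simp add: card_image)
qed

lemma edge_adjacency_eq_dart_rel:
  assumes "inv_closed B"
  shows "{(u, w). u \<in> verts \<and> w \<in> verts \<and> u \<noteq> w \<and> (\<exists>e\<in>edge_of \<alpha> ` B. e \<inter> u \<noteq> {} \<and> e \<inter> w \<noteq> {})} =
    dart_rel vert B" (is "?L = _")
proof (intro equalityI subrelI)
  fix u w assume "(u, w) \<in> ?L"
  then obtain x where x: "u \<in> verts" "w \<in> verts" "u \<noteq> w" "x \<in> B"
    "edge_of \<alpha> x \<inter> u \<noteq> {}" "edge_of \<alpha> x \<inter> w \<noteq> {}" by blast
  then have "vert x = u \<and> vert (\<alpha> x) = w \<or> vert (\<alpha> x) = u \<and> vert x = w"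
    using in_verts_iff[of u] in_verts_iff[of w] by (auto simp: edge_of_def)
  then show "(u, w) \<in> dart_rel vert B"
    using dart_relI[OF x(4), of vert] dart_rel_sym[OF assms dart_relI[OF x(4)], of vert] by auto
next
  fix u w assume "(u, w) \<in> dart_rel vert B"
  then obtain x where x: "x \<in> B" "u = vert x" "w = vert (\<alpha> x)" by (auto simp: dart_rel_def)
  then have "x \<in> D" using inv_closed_subset[OF assms] by blast
  moreover have "x \<in> edge_of \<alpha> x \<inter> vert x" "\<alpha> x \<in> edge_of \<alpha> x \<inter> vert (\<alpha> x)"
    using vert_self by (auto simp: edge_of_def)
  ultimately show "(u, w) \<in> ?L" using x inv_vert_neq[of x] by auto
qed

lemma ham_cycle_iff:
  assumes "inv_closed B"
  shows "ham_cycle D \<alpha> \<sigma> (edge_of \<alpha> ` B) \<longleftrightarrow>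
    (\<forall>d\<in>D. card {x\<in>B. vert x = vert d} = 2) \<and> dart_connected vert B verts"
proof -
  have "edge_of \<alpha> ` B \<subseteq> map_edges D \<alpha>"
    using inv_closed_subset[OF assms] by (auto simp: map_edges_def)
  moreover have "(\<forall>v\<in>verts. card {e\<in>edge_of \<alpha> ` B. e \<inter> v \<noteq> {}} = 2) \<longleftrightarrow>
      (\<forall>d\<in>D. card {x\<in>B. vert x = vert d} = 2)"
    using card_edges_at_vert[OF assms] by (simp add: map_verts_def)
  ultimately show ?thesis
    unfolding ham_cycle_def sg_connected_def dart_connected_def edge_adjacency_eq_dart_rel[OF assms]
    by simp
qed

lemma ham_region_imp_ham_cycle:
  "ham_region a b S \<Longrightarrow> ham_cycle D \<alpha> \<sigma> (edge_of \<alpha> ` boundary S)"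
  using ham_cycle_iff[OF inv_closed_boundary] card_boundary_at_vert
  unfolding ham_region_def by blast

lemma outside_faces_eq:
  assumes "inv_closed B"
  shows "outside_faces D \<alpha> \<sigma> (edge_of \<alpha> ` B) F = {F'. (F, F') \<in> (dart_rel face (D - B))\<^sup>*}"
proof -
  have "{(F1, F2). \<exists>d\<in>D. face d = F1 \<and> face (\<alpha> d) = F2 \<and> edge_of \<alpha> d \<notin> edge_of \<alpha> ` B} =
      dart_rel face (D - B)"
    using edge_of_image_iff[OF assms] by (auto simp: dart_rel_def)
  then show ?thesis by (simp add: outside_faces_def)
qed

lemma ham_region_outside_faces:
  assumes "ham_region a b S" "F \<in> face ` (D - S)"
  shows "outside_faces D \<alpha> \<sigma> (edge_of \<alpha> ` boundary S) F = face ` (D - S)"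
  unfolding outside_faces_eq[OF inv_closed_boundary]
proof (intro equalityI subsetI)
  have reg: "region a b S" using assms(1) by (simp add: ham_region_def)
  fix F' assume "F' \<in> {F'. (F, F') \<in> (dart_rel face (D - boundary S))\<^sup>*}"
  then have "(F, F') \<in> (dart_rel face (D - boundary S))\<^sup>*" by simp
  then show "F' \<in> face ` (D - S)"
  proof (induction rule: rtrancl_induct)
    case (step F1 F2)
    then obtain d x where d: "d \<in> D - boundary S" "F1 = face d" "F2 = face (\<alpha> d)"
      "x \<in> D - S" "face d = face x"
      by (auto simp: dart_rel_def)
    then have "\<alpha> d \<in> D - S" using region_face_eq[OF reg d(5)] by (auto simp: boundary_def)
    then show ?case using d(3) by blast
  qed (rule assms(2))
next
  fix F' assume "F' \<in> face ` (D - S)"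
  moreover have "interior_darts (D - S) \<subseteq> D - boundary S"
    by (auto simp: interior_darts_def boundary_def)
  then have "dart_connected face (D - boundary S) (face ` (D - S))"
    using ham_region_interior_connected[OF ham_region_complement[OF assms(1)]] dart_connected_mono
    by blast
  ultimately show "F' \<in> {F'. (F, F') \<in> (dart_rel face (D - boundary S))\<^sup>*}"
    using assms(2) unfolding dart_connected_def by blast
qed

lemma boundary_of_outside_faces:
  assumes "inv_closed B" "\<And>d. d \<in> D \<Longrightarrow> card {x\<in>B. vert x = vert d} = 2"
    and S: "S = {d\<in>D. face d \<notin> outside_faces D \<alpha> \<sigma> (edge_of \<alpha> ` B) F}" and reg: "region a b S"
  shows "boundary S = B"
proof -
  have "d \<in> S \<longleftrightarrow> \<alpha> d \<in> S" if "d \<in> D - B" for d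
  proof -
    have "\<alpha> d \<in> D - B" using that inv_closedD[OF assms(1)] by simp
    then have "(face d, face (\<alpha> d)) \<in> dart_rel face (D - B)"
      "(face (\<alpha> d), face d) \<in> dart_rel face (D - B)"
      using that dart_relI[of _ "D - B" face] inv_inv[of d] by (blast, metis)
    then show ?thesis
      using that unfolding S outside_faces_eq[OF assms(1)] by (auto intro: rtrancl_into_rtrancl)
  qed
  then have sub: "boundary S \<subseteq> B" by (auto simp: boundary_def)
  have "x \<in> boundary S" if "x \<in> B" for x
  proof -
    have xD: "x \<in> D" using that inv_closed_subset[OF assms(1)] by blast
    have "{y\<in>boundary S. vert y = vert x} = {y\<in>B. vert y = vert x}"
      using sub assms(2)[OF xD] card_boundary_at_vert[OF reg xD] inv_closed_finite[OF assms(1)]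
      by (intro card_subset_eq) auto
    then show ?thesis using that by blast
  qed
  then show ?thesis using sub by blast
qed

theorem ham_cycle_iff_ham_region:
  assumes "F \<in> faces" "col F = b" "a \<in> {1, 2, 3}"
  shows "(\<exists>C. ham_cycle D \<alpha> \<sigma> C \<and>
             (\<forall>F'\<in>faces. col F' = a \<longrightarrow> F' \<notin> outside_faces D \<alpha> \<sigma> C F) \<and>
             (\<forall>F'\<in>faces. col F' = b \<longrightarrow> F' \<in> outside_faces D \<alpha> \<sigma> C F))
         \<longleftrightarrow> (\<exists>S. ham_region a b S)" (is "?cycle \<longleftrightarrow> ?region")
proof
  assume ?cycle
  then obtain C where C: "ham_cycle D \<alpha> \<sigma> C"
    and inside: "\<And>F'. F' \<in> faces \<Longrightarrow> col F' = a \<Longrightarrow> F' \<notin> outside_faces D \<alpha> \<sigma> C F"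
    and outside: "\<And>F'. F' \<in> faces \<Longrightarrow> col F' = b \<Longrightarrow> F' \<in> outside_faces D \<alpha> \<sigma> C F" by blast
  define B where "B = {d\<in>D. edge_of \<alpha> d \<in> C}"
  have B: "inv_closed B" by (simp add: inv_closed_def B_def)
  have "C \<subseteq> map_edges D \<alpha>" using C by (simp add: ham_cycle_def)
  then have CB: "C = edge_of \<alpha> ` B" by (auto simp: B_def map_edges_def)
  then have two: "\<And>d. d \<in> D \<Longrightarrow> card {x\<in>B. vert x = vert d} = 2"
    and conn: "dart_connected vert B verts"
    using C ham_cycle_iff[OF B] by simp_all
  define S where "S = {d\<in>D. face d \<notin> outside_faces D \<alpha> \<sigma> C F}"
  have "b \<in> {1, 2, 3}" using assms(1,2) dcol_in by (metis facesE)
  then have reg: "region a b S"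
  proof (intro regionI)
    show "dcol d \<noteq> b" if "d \<in> S" for d using that outside[of "face d"] by (auto simp: S_def)
  qed (use assms(3) inside in \<open>auto simp: S_def\<close>)
  then have "boundary S = B" using B two S_def unfolding CB by (intro boundary_of_outside_faces)
  then show ?region using conn reg by (auto simp: ham_region_def)
next
  assume ?region
  then obtain S where S: "ham_region a b S" by blast
  then have reg: "region a b S" by (simp add: ham_region_def)
  obtain d where "d \<in> D" "face d = F" using assms(1) by (rule facesE)
  then have "F \<in> face ` (D - S)" using reg assms(2) by (auto simp: region_def)
  note out = ham_region_outside_faces[OF S this]
  have "F' \<notin> face ` (D - S)" if "F' \<in> faces" "col F' = a" for F'
    using that reg by (auto simp: region_def)
  moreover have "F' \<in> face ` (D - S)" if F': "F' \<in> faces" "col F' = b" for F'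
  proof -
    obtain x where "x \<in> D" "face x = F'" using F'(1) by (rule facesE)
    then show ?thesis using reg F'(2) by (auto simp: region_def)
  qed
  ultimately show ?cycle using ham_region_imp_ham_cycle[OF S] out by metis
qed

section \<open>Reduced graphs\<close>

lemma sum_dcol_vert:
  assumes "d \<in> D" shows "dcol d + dcol (\<sigma> d) + dcol (\<sigma> (\<sigma> d)) = 6"
proof -
  have "dcol d + dcol (\<sigma> d) + dcol (\<sigma> (\<sigma> d)) = (\<Sum>x\<in>vert d. dcol x)"
    using cubic_rotation[OF assms] by simp
  also have "\<dots> = (\<Sum>i\<in>{1, 2, 3}. i)"
    using bij_betw_dcol_vert[OF assms] by (rule sum.reindex_bij_betw)
  finally show ?thesis by simp
qed

lemma dcol_inv_face_step2:
  assumes "d \<in> D" shows "dcol (\<alpha> (\<sigma> (\<alpha> (\<sigma> (\<alpha> d))))) = dcol (\<alpha> d)"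
proof -
  let ?e = "\<sigma> (\<alpha> d)"
  have "dcol (\<alpha> d) + dcol d + dcol (\<alpha> ?e) = 6"
    using sum_dcol_vert[of "\<alpha> d"] assms by simp
  moreover have "dcol (\<alpha> ?e) + dcol d + dcol (\<alpha> (\<sigma> (\<alpha> ?e))) = 6"
    using sum_dcol_vert[of "\<alpha> ?e"] assms by simp
  ultimately show ?thesis by simp
qed

lemma red_fv_iff:
  assumes "X \<in> faces" "F \<in> faces" "X \<noteq> F"
  shows "red_fv D \<sigma> F X \<longleftrightarrow> (\<exists>z\<in>D. face z = X \<and> face (\<alpha> z) = F)"
proof
  assume "red_fv D \<sigma> F X"
  then obtain d x y where "d \<in> D" "y \<in> vert d" "y \<in> F" "x \<in> vert d" "x \<in> X"
    by (auto simp: red_fv_def)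
  then have d: "d \<in> D" "vert y = vert d" "face y = F" "vert x = vert d" "face x = X"
    using in_faces_iff[OF assms(1)] in_faces_iff[OF assms(2)] by (simp_all add: in_vert_iff)
  then have "y \<in> D" "vert x = vert y" using vert_eq_imp_in[of y d] by simp_all
  from this(2,1) show "\<exists>z\<in>D. face z = X \<and> face (\<alpha> z) = F"
  proof (rule vert_eqE)
    assume "x = y" then show ?thesis using d assms(3) by simp
  next
    assume "x = \<sigma> y"
    then show ?thesis using \<open>y \<in> D\<close> d by (intro bexI[of _ "\<alpha> y"]) simp_all
  next
    assume "x = \<sigma> (\<sigma> y)"
    then show ?thesis using \<open>y \<in> D\<close> d by (intro bexI[of _ x]) simp_all
  qed
next
  assume "\<exists>z\<in>D. face z = X \<and> face (\<alpha> z) = F"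
  then obtain z where z: "z \<in> D" "face z = X" "face (\<sigma> z) = F" by auto
  then have "z \<in> vert z \<inter> X" "\<sigma> z \<in> vert z \<inter> F"
    using face_self[of z] face_self[of "\<sigma> z"] by (simp_all add: in_vert_iff)
  then show "red_fv D \<sigma> F X" using z(1) by (auto simp: red_fv_def)
qed

lemma red_fe_disjoint:
  assumes "F \<in> faces" "F' \<in> faces" "F \<noteq> F'" "col F = col F'"
  shows "\<not> (\<exists>e. red_fe D \<alpha> \<sigma> col i F e \<and> red_fe D \<alpha> \<sigma> col i F' e)"
proof
  assume "\<exists>e. red_fe D \<alpha> \<sigma> col i F e \<and> red_fe D \<alpha> \<sigma> col i F' e"
  then obtain d where d: "d \<in> D" "{d, \<alpha> d} \<inter> F \<noteq> {}" "{d, \<alpha> d} \<inter> F' \<noteq> {}"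
    by (auto simp: red_fe_def red_edges_def map_edges_def edge_of_def)
  then have "face d = F \<or> face (\<alpha> d) = F" "face d = F' \<or> face (\<alpha> d) = F'"
    using in_faces_iff[OF assms(1)] in_faces_iff[OF assms(2)] by auto
  then show False using assms(3,4) dcol_inv_neq[OF d(1)] by metis
qed

section \<open>Spanning trees of faces\<close>

definition face_region :: "nat \<Rightarrow> 'd set set \<Rightarrow> 'd set" where
  "face_region a T = {d\<in>D. dcol d = a \<or> face d \<in> T}"

lemma face_image_face_region:
  assumes "T \<subseteq> faces" shows "face ` face_region a T = red_verts D \<alpha> \<sigma> col a \<union> T"
proof (intro equalityI subsetI)
  fix F assume F: "F \<in> red_verts D \<alpha> \<sigma> col a \<union> T"
  then have "F \<in> faces" using assms by (auto simp: red_verts_def)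
  then obtain d where "d \<in> D" "face d = F" by (rule facesE)
  then show "F \<in> face ` face_region a T" using F by (auto simp: face_region_def red_verts_def)
qed (auto simp: face_region_def red_verts_def)

lemma region_face_region:
  assumes colours: "{a, b, c} = {1, 2, 3}" and T: "\<forall>F\<in>T. col F = c"
  shows "region a b (face_region a T)"
proof -
  have "{a, b} \<subseteq> {1, 2, 3}" using colours by blast
  then show ?thesis
    using T colours_distinct[OF colours] by (intro regionI) (auto simp: face_region_def)
qed

lemma region_eq_face_region:
  assumes colours: "{a, b, c} = {1, 2, 3}" and reg: "region a b S"
  shows "S = face_region a {F \<in> face ` S. col F = c}"
proof -
  have "d \<in> S \<longleftrightarrow> d \<in> D \<and> (dcol d = a \<or> face d \<in> face ` S \<and> dcol d = c)" for d
  proof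
    assume "d \<in> S"
    then have "d \<in> D" "dcol d \<noteq> b" using reg by (auto simp: region_def)
    then show "d \<in> D \<and> (dcol d = a \<or> face d \<in> face ` S \<and> dcol d = c)"
      using dcol_in[of d] \<open>d \<in> S\<close> unfolding colours[symmetric] by blast
  next
    assume d: "d \<in> D \<and> (dcol d = a \<or> face d \<in> face ` S \<and> dcol d = c)"
    show "d \<in> S"
    proof (cases "dcol d = a")
      case True
      then show ?thesis using d reg by (simp add: region_def)
    next
      case False
      then obtain x where "face d = face x" "x \<in> S" using d by blast
      then show ?thesis using region_face_eq[OF reg] by blast
    qed
  qed
  then show ?thesis unfolding face_region_def by blast
qed

text \<open>The radial graph of the reduced graph has the faces of colour \<open>a\<close> as its left nodes.\<close>

definition radial_node :: "nat \<Rightarrow> 'd set \<Rightarrow> 'd set + 'd set" where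
  "radial_node a F = (if col F = a then Inl F else Inr F)"

lemma radial_adj_iff:
  assumes colours: "{a, b, c} = {1, 2, 3}" and reg: "region a b S"
    and XY: "X \<in> face ` S" "Y \<in> face ` S"
  shows "radial_adj (red_fv D \<sigma>) (radial_node a X) (radial_node a Y) \<longleftrightarrow>
    (X, Y) \<in> dart_rel face (interior_darts S)"
proof -
  let ?adj = "\<lambda>X Y. \<exists>z\<in>D. face z = X \<and> face (\<alpha> z) = Y"
  have faces: "X \<in> faces" "Y \<in> faces" using XY region_subset[OF reg] by auto
  have "z \<in> S" if "face z = X \<or> face z = Y" for z
    using that XY region_face_eq[OF reg, of z] by blast
  then have rel: "(X, Y) \<in> dart_rel face (interior_darts S) \<longleftrightarrow> ?adj X Y"
    using region_subset[OF reg] unfolding dart_rel_def interior_darts_def by blast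
  have sym: "?adj Y X \<longleftrightarrow> ?adj X Y" by (metis inv_in_iff inv_inv)
  have "col X \<noteq> b" "col Y \<noteq> b" using XY reg by (auto simp: region_def)
  then have cols: "col X \<in> {a, c}" "col Y \<in> {a, c}"
    using faces coloring colours unfolding proper_face_3_coloring_def by blast+
  show ?thesis
  proof (cases "col X = col Y")
    case True
    then have "\<not> ?adj X Y" using dcol_inv_neq by metis
    then show ?thesis using True unfolding rel by (simp add: radial_adj_def radial_node_def)
  next
    case False
    then have "X \<noteq> Y" by blast
    then have "red_fv D \<sigma> Y X \<longleftrightarrow> ?adj X Y" "red_fv D \<sigma> X Y \<longleftrightarrow> ?adj X Y"
      using red_fv_iff[OF faces] red_fv_iff[OF faces(2,1)] sym by blast+
    then show ?thesis
      using False cols unfolding rel by (simp only: radial_adj_def radial_node_def) auto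
  qed
qed

section \<open>A-trails\<close>

text \<open>In the graph reduced by contracting the faces of colour \<open>c\<close>, an uncontracted dart \<open>d\<close> starts
  at the vertex \<open>apex d\<close>.\<close>

definition uncontracted :: "nat \<Rightarrow> 'd set" where
  "uncontracted c = {d\<in>D. dcol d \<noteq> c \<and> dcol (\<alpha> d) \<noteq> c}"

definition apex :: "'d \<Rightarrow> 'd set" where
  "apex d = face (\<sigma> (\<sigma> d))"

definition edge_faces :: "'d \<Rightarrow> 'd set set" where
  "edge_faces d = {face d, face (\<alpha> d)}"

lemma inv_closed_uncontracted: "inv_closed (uncontracted c)"
  unfolding inv_closed_def uncontracted_def by (auto simp del: face_inv)

lemma uncontracted_iff:
  assumes "c \<in> {1, 2, 3}" "d \<in> D" shows "d \<in> uncontracted c \<longleftrightarrow> dcol (\<sigma> (\<sigma> d)) = c"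
proof -
  have "c \<in> dcol ` vert d"
    using bij_betw_dcol_vert[OF assms(2)] assms(1) by (simp add: bij_betw_def)
  then have "c \<in> {dcol d, dcol (\<sigma> d), dcol (\<sigma> (\<sigma> d))}" using cubic_rotation(1)[OF assms(2)] by simp
  then show ?thesis using dcol_rot_neq[OF assms(2)] assms(2) by (auto simp: uncontracted_def)
qed

lemma uncontracted_eqI:
  assumes colour: "c \<in> {1, 2, 3}"
    and xy: "x \<in> uncontracted c" "y \<in> uncontracted c" "vert x = vert y"
  shows "x = y"
proof -
  have D: "x \<in> D" "y \<in> D" using xy by (simp_all add: uncontracted_def)
  then have "dcol (\<sigma> (\<sigma> x)) = dcol (\<sigma> (\<sigma> y))" using uncontracted_iff[OF colour] xy by simp
  moreover have "\<sigma> (\<sigma> x) \<in> vert y" "\<sigma> (\<sigma> y) \<in> vert y" using xy(3) by (simp_all add: in_vert_iff)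
  ultimately have "\<sigma> (\<sigma> x) = \<sigma> (\<sigma> y)"
    by (rule inj_onD[OF bij_betw_imp_inj_on[OF bij_betw_dcol_vert[OF D(2)]]])
  then show ?thesis by simp
qed

lemma uncontracted_at_vert:
  assumes "c \<in> {1, 2, 3}" "v \<in> verts"
  obtains d where "d \<in> uncontracted c" "vert d = v"
proof -
  obtain d where d: "d \<in> D" "vert d = v" using assms(2) by (rule vertsE)
  obtain x where "x \<in> D" "vert x = vert d" "dcol x = c" using vert_colour[OF d(1) assms(1)] .
  then show thesis using that[of "\<sigma> x"] uncontracted_iff[OF assms(1)] d(2) by simp
qed

lemma bij_betw_vert_uncontracted:
  assumes "c \<in> {1, 2, 3}" shows "bij_betw vert (uncontracted c) verts"
proof (rule bij_betw_imageI)
  show "inj_on vert (uncontracted c)" using uncontracted_eqI[OF assms] by (rule inj_onI)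
  have "v \<in> vert ` uncontracted c" if "v \<in> verts" for v
    using uncontracted_at_vert[OF assms that] by blast
  then show "vert ` uncontracted c = verts" by (auto simp: uncontracted_def)
qed

lemma red_edges_eq: "red_edges D \<alpha> \<sigma> col c = edge_of \<alpha> ` uncontracted c"
proof -
  have "(\<forall>F\<in>faces. col F = c \<longrightarrow> edge_of \<alpha> d \<inter> F = {}) \<longleftrightarrow>
      dcol d \<noteq> c \<and> dcol (\<alpha> d) \<noteq> c" if "d \<in> D" for d
  proof
    assume avoids: "\<forall>F\<in>faces. col F = c \<longrightarrow> edge_of \<alpha> d \<inter> F = {}"
    have "d \<in> edge_of \<alpha> d \<inter> face d" "\<alpha> d \<in> edge_of \<alpha> d \<inter> face (\<alpha> d)"
      by (simp_all add: edge_of_def in_face_iff)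
    moreover have "face d \<in> faces" "face (\<alpha> d) \<in> faces" using that by simp_all
    ultimately show "dcol d \<noteq> c \<and> dcol (\<alpha> d) \<noteq> c" using avoids by blast
  next
    assume "dcol d \<noteq> c \<and> dcol (\<alpha> d) \<noteq> c"
    then show "\<forall>F\<in>faces. col F = c \<longrightarrow> edge_of \<alpha> d \<inter> F = {}"
      using in_faces_iff by (auto simp: edge_of_def)
  qed
  then show ?thesis unfolding red_edges_def map_edges_def uncontracted_def by blast
qed

lemma red_fe_iff:
  assumes "d \<in> uncontracted c" "F \<in> faces"
  shows "red_fe D \<alpha> \<sigma> col c F (edge_of \<alpha> d) \<longleftrightarrow> F \<in> edge_faces d"
  using assms in_faces_iff[OF assms(2)] unfolding red_fe_def red_edges_eq
  by (auto simp: edge_of_def edge_faces_def)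

lemma apex_in_red_verts:
  assumes "c \<in> {1, 2, 3}" "d \<in> uncontracted c" shows "apex d \<in> red_verts D \<alpha> \<sigma> col c"
  using assms uncontracted_iff[of c d] by (auto simp: apex_def red_verts_def uncontracted_def)

lemma red_verts_at_vert_iff:
  assumes "c \<in> {1, 2, 3}" "d \<in> uncontracted c"
  shows "X \<in> red_verts D \<alpha> \<sigma> col c \<and> X \<inter> vert d \<noteq> {} \<longleftrightarrow> X = apex d"
proof
  have dD: "d \<in> D" using assms(2) by (simp add: uncontracted_def)
  assume X: "X \<in> red_verts D \<alpha> \<sigma> col c \<and> X \<inter> vert d \<noteq> {}"
  then obtain y where y: "y \<in> X" "y \<in> vert d" by blast
  then have "face y = X" "dcol y = c" using X in_faces_iff by (auto simp: red_verts_def)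
  moreover have "y = \<sigma> (\<sigma> d)"
    using y(2) \<open>dcol y = c\<close> assms(2) cubic_rotation(1)[OF dD] by (auto simp: uncontracted_def)
  ultimately show "X = apex d" by (simp add: apex_def)
next
  assume "X = apex d"
  moreover have "\<sigma> (\<sigma> d) \<in> apex d \<inter> vert d" using face_self by (simp add: apex_def in_vert_iff)
  ultimately show "X \<in> red_verts D \<alpha> \<sigma> col c \<and> X \<inter> vert d \<noteq> {}"
    using apex_in_red_verts[OF assms] by blast
qed

lemma red_ends_eq:
  assumes "c \<in> {1, 2, 3}" "d \<in> uncontracted c"
  shows "red_ends D \<alpha> \<sigma> col c (edge_of \<alpha> d) = {apex d, apex (\<alpha> d)}"
proof -
  have "\<alpha> d \<in> uncontracted c" using inv_closedD[OF inv_closed_uncontracted] assms(2) by blast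
  note at_ends = red_verts_at_vert_iff[OF assms] red_verts_at_vert_iff[OF assms(1) this]
  have "red_ends D \<alpha> \<sigma> col c (edge_of \<alpha> d) =
      {X. (X \<in> red_verts D \<alpha> \<sigma> col c \<and> X \<inter> vert d \<noteq> {}) \<or>
          (X \<in> red_verts D \<alpha> \<sigma> col c \<and> X \<inter> vert (\<alpha> d) \<noteq> {})}"
    unfolding red_ends_def edge_of_def by blast
  then show ?thesis unfolding at_ends by blast
qed

lemma ex_uncontracted_with_ends:
  assumes colour: "c \<in> {1, 2, 3}" and "e \<in> edge_of \<alpha> ` uncontracted c"
    and "red_ends D \<alpha> \<sigma> col c e = {X, Y}"
  shows "\<exists>d. d \<in> uncontracted c \<and> edge_of \<alpha> d = e \<and> apex d = X \<and> apex (\<alpha> d) = Y"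
proof -
  obtain d where d: "d \<in> uncontracted c" "edge_of \<alpha> d = e" using assms(2) by blast
  then have "\<alpha> d \<in> uncontracted c" using inv_closedD[OF inv_closed_uncontracted] by blast
  moreover have "{apex d, apex (\<alpha> d)} = {X, Y}"
    using assms(3) red_ends_eq[OF colour d(1)] d(2) by simp
  ultimately show ?thesis using d by (metis doubleton_eq_iff edge_of_inv inv_inv)
qed

lemma edge_faces_inv: "edge_faces (\<alpha> d) = edge_faces d"
  by (auto simp: edge_faces_def)

lemma edge_faces_at_vert:
  assumes "vert z = vert d" "d \<in> D" "z \<noteq> d"
  obtains F where "F \<in> edge_faces d" "edge_faces z = {apex d, F}"
  using assms(1,2)
proof (rule vert_eqE)
  assume "z = \<sigma> d"
  then show thesis using that[of "face (\<alpha> d)"] by (simp add: edge_faces_def apex_def insert_commute)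
next
  assume "z = \<sigma> (\<sigma> d)"
  then show thesis using that[of "face d"] by (simp add: edge_faces_def apex_def)
qed (use assms(3) in blast)

lemma ex_dart_at_vert_with_edge_faces:
  assumes "d \<in> D" "F \<in> edge_faces d"
  obtains z where "vert z = vert d" "z \<in> D" "edge_faces z = {apex d, F}"
proof -
  have "edge_faces (\<sigma> d) = {apex d, face (\<alpha> d)}" "edge_faces (\<sigma> (\<sigma> d)) = {apex d, face d}"
    by (simp_all add: edge_faces_def apex_def insert_commute)
  then show thesis using that[of "\<sigma> d"] that[of "\<sigma> (\<sigma> d)"] assms by (auto simp: edge_faces_def)
qed

text \<open>The edge \<open>z\<close> of a contracted face is the corner of the reduced graph between \<open>d\<close> and \<open>d'\<close>.\<close>

definition joined :: "nat \<Rightarrow> 'd \<Rightarrow> 'd \<Rightarrow> bool" where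
  "joined c d d' \<longleftrightarrow> (\<exists>z\<in>D - uncontracted c. vert z = vert d \<and> vert (\<alpha> z) = vert d')"

definition dart_trail :: "nat \<Rightarrow> nat \<Rightarrow> (nat \<Rightarrow> 'd) \<Rightarrow> bool" where
  "dart_trail c m x \<longleftrightarrow> 0 < m \<and> x m = x 0 \<and>
     bij_betw (\<lambda>i. edge_of \<alpha> (x i)) {..<m} (edge_of \<alpha> ` uncontracted c) \<and>
     (\<forall>i<m. joined c (\<alpha> (x i)) (x (Suc i)))"

lemma dart_trail_in:
  assumes "dart_trail c m x" "i \<le> m" shows "x i \<in> uncontracted c"
proof -
  have "x i \<in> uncontracted c" if "i < m" for i
    using assms(1) that edge_of_image_iff[OF inv_closed_uncontracted]
    unfolding dart_trail_def by (metis bij_betwE lessThan_iff)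
  then show ?thesis using assms unfolding dart_trail_def by (metis le_neq_implies_less)
qed

lemma dart_trail_cases:
  assumes "dart_trail c m x" "d \<in> uncontracted c"
  obtains (tail) i where "i < m" "d = \<alpha> (x i)" | (head) i where "i < m" "d = x (Suc i)"
proof -
  have "edge_of \<alpha> d \<in> (\<lambda>i. edge_of \<alpha> (x i)) ` {..<m}"
    using assms by (auto simp: dart_trail_def bij_betw_def)
  then obtain i where i: "i < m" "d = x i \<or> d = \<alpha> (x i)" by (auto simp: edge_of_eq_iff)
  have "\<exists>j<m. x i = x (Suc j)"
  proof (cases i)
    case 0
    then show ?thesis using assms(1) by (intro exI[of _ "m - 1"]) (simp add: dart_trail_def)
  next
    case (Suc j)
    then show ?thesis using i(1) by (intro exI[of _ j]) simp
  qed
  then show thesis using that i by blast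
qed

lemma dart_trail_card:
  assumes "c \<in> {1, 2, 3}" "dart_trail c m x" shows "card verts = 2 * m"
proof -
  have "card verts = card (uncontracted c)"
    using bij_betw_same_card[OF bij_betw_vert_uncontracted[OF assms(1)]] by simp
  also have "\<dots> = 2 * card (edge_of \<alpha> ` uncontracted c)"
    using inv_closed_uncontracted by (rule card_eq_twice_card_edges)
  also have "card (edge_of \<alpha> ` uncontracted c) = m"
    using assms(2) bij_betw_same_card unfolding dart_trail_def by (metis card_lessThan)
  finally show ?thesis .
qed

lemma joinedD:
  assumes colour: "c \<in> {1, 2, 3}" and d: "d \<in> uncontracted c" "d' \<in> uncontracted c"
    and "joined c d d'"
  shows "apex d = apex d'" "edge_faces d \<inter> edge_faces d' \<noteq> {}"
proof -
  obtain z where z: "z \<in> D" "z \<notin> uncontracted c" "vert z = vert d" "vert (\<alpha> z) = vert d'"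
    using assms(4) by (auto simp: joined_def)
  have D: "d \<in> D" "d' \<in> D" using d by (simp_all add: uncontracted_def)
  have "\<alpha> z \<notin> uncontracted c" using z(2) inv_closedD[OF inv_closed_uncontracted] by blast
  then have "z \<noteq> d" "\<alpha> z \<noteq> d'" using z(2) d by blast+
  then obtain F F' where F: "F \<in> edge_faces d" "edge_faces z = {apex d, F}"
    and F': "F' \<in> edge_faces d'" "edge_faces z = {apex d', F'}"
    using edge_faces_at_vert[OF z(3) D(1)] edge_faces_at_vert[OF z(4) D(2)]
    by (metis edge_faces_inv)
  have "col (apex d) = c" "col (apex d') = c" "col F \<noteq> c" "col F' \<noteq> c"
    using apex_in_red_verts[OF colour] d F(1) F'(1)
    by (auto simp: red_verts_def edge_faces_def uncontracted_def)
  then show "apex d = apex d'" "edge_faces d \<inter> edge_faces d' \<noteq> {}"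
    using F F' by (auto simp: doubleton_eq_iff)
qed

lemma dart_trail_imp_reduced_has_A_trail:
  assumes colour: "c \<in> {1, 2, 3}" and trail: "dart_trail c m x"
  shows "reduced_has_A_trail D \<alpha> \<sigma> col c"
proof -
  let ?es = "map (\<lambda>i. edge_of \<alpha> (x i)) [0..<m]" and ?vs = "map (\<lambda>i. apex (x i)) [0..<m]"
  have m: "0 < m" and bij: "bij_betw (\<lambda>i. edge_of \<alpha> (x i)) {0..<m} (edge_of \<alpha> ` uncontracted c)"
    using trail by (auto simp: dart_trail_def lessThan_atLeast0)
  have Suc_mod: "x ((i + 1) mod m) = x (Suc i)" if "i < m" for i
    using that trail by (cases "Suc i = m") (auto simp: dart_trail_def)
  have "is_A_trail (red_verts D \<alpha> \<sigma> col c) (red_edges D \<alpha> \<sigma> col c)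
      (red_ends D \<alpha> \<sigma> col c) (red_faces D \<alpha> \<sigma> col c) (red_fe D \<alpha> \<sigma> col c) ?es ?vs"
    unfolding is_A_trail_def Let_def
  proof (intro conjI allI impI)
    show "distinct ?es" "set ?es = red_edges D \<alpha> \<sigma> col c"
      using bij by (simp_all add: distinct_map bij_betw_def red_edges_eq)
    show "set ?vs \<subseteq> red_verts D \<alpha> \<sigma> col c"
      using apex_in_red_verts[OF colour] dart_trail_in[OF trail] by auto
    fix i assume "i < length ?es"
    then have i: "i < m" by simp
    have U: "x i \<in> uncontracted c" "\<alpha> (x i) \<in> uncontracted c" "x (Suc i) \<in> uncontracted c"
      using dart_trail_in[OF trail] i inv_closedD[OF inv_closed_uncontracted] by simp_all
    have nth: "?es ! i = edge_of \<alpha> (x i)" "?vs ! i = apex (x i)"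
        "?es ! ((i + 1) mod length ?es) = edge_of \<alpha> (x (Suc i))"
        "?vs ! ((i + 1) mod length ?es) = apex (x (Suc i))"
      using i m Suc_mod[OF i] by simp_all
    have "joined c (\<alpha> (x i)) (x (Suc i))" using trail i by (simp add: dart_trail_def)
    then have apex: "apex (\<alpha> (x i)) = apex (x (Suc i))"
      and common: "edge_faces (x i) \<inter> edge_faces (x (Suc i)) \<noteq> {}"
      using joinedD[OF colour U(2,3)] by (simp_all add: edge_faces_inv)
    show "red_ends D \<alpha> \<sigma> col c (?es ! i) = {?vs ! i, ?vs ! ((i + 1) mod length ?es)}"
      unfolding nth apex[symmetric] using colour U(1) by (rule red_ends_eq)
    obtain F where F: "F \<in> edge_faces (x i)" "F \<in> edge_faces (x (Suc i))" using common by blast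
    then have "F \<in> red_faces D \<alpha> \<sigma> col c" "F \<in> faces"
      using U(1) by (auto simp: edge_faces_def uncontracted_def red_faces_def)
    then show "\<exists>F\<in>red_faces D \<alpha> \<sigma> col c. red_fe D \<alpha> \<sigma> col c F (?es ! i) \<and>
        red_fe D \<alpha> \<sigma> col c F (?es ! ((i + 1) mod length ?es))"
      unfolding nth using F red_fe_iff U(1,3) by blast
  qed (use m in simp_all)
  then show ?thesis by (auto simp: reduced_has_A_trail_def has_A_trail_def)
qed

lemma reduced_has_A_trailE:
  assumes colour: "c \<in> {1, 2, 3}" and "reduced_has_A_trail D \<alpha> \<sigma> col c"
  obtains m x where "0 < m" "x m = x 0"
    "bij_betw (\<lambda>i. edge_of \<alpha> (x i)) {..<m} (edge_of \<alpha> ` uncontracted c)" "\<And>i. x i \<in> uncontracted c"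
    "\<And>i. i < m \<Longrightarrow> apex (\<alpha> (x i)) = apex (x (Suc i))"
    "\<And>i. i < m \<Longrightarrow> edge_faces (x i) \<inter> edge_faces (x (Suc i)) \<noteq> {}"
proof -
  let ?U = "uncontracted c"
  obtain es vs where "is_A_trail (red_verts D \<alpha> \<sigma> col c) (red_edges D \<alpha> \<sigma> col c)
      (red_ends D \<alpha> \<sigma> col c) (red_faces D \<alpha> \<sigma> col c) (red_fe D \<alpha> \<sigma> col c) es vs"
    using assms(2) by (auto simp: reduced_has_A_trail_def has_A_trail_def)
  moreover define m where "m = length es"
  ultimately have m: "0 < m" and es: "distinct es" "set es = edge_of \<alpha> ` ?U"
    and ends: "\<And>i. i < m \<Longrightarrow> red_ends D \<alpha> \<sigma> col c (es ! i) = {vs ! i, vs ! (Suc i mod m)}"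
    and common: "\<And>i. i < m \<Longrightarrow> \<exists>F\<in>red_faces D \<alpha> \<sigma> col c.
        red_fe D \<alpha> \<sigma> col c F (es ! i) \<and> red_fe D \<alpha> \<sigma> col c F (es ! (Suc i mod m))"
    by (simp_all add: is_A_trail_def Let_def red_edges_eq)
  have "\<exists>d. d \<in> ?U \<and> edge_of \<alpha> d = es ! i \<and> apex d = vs ! i \<and> apex (\<alpha> d) = vs ! (Suc i mod m)"
    if "i < m" for i
    using es(2) ends[OF that] that nth_mem[of i es] m_def
    by (intro ex_uncontracted_with_ends[OF colour]) simp_all
  then obtain y where y: "\<And>i. i < m \<Longrightarrow> y i \<in> ?U" "\<And>i. i < m \<Longrightarrow> edge_of \<alpha> (y i) = es ! i"
    "\<And>i. i < m \<Longrightarrow> apex (y i) = vs ! i" "\<And>i. i < m \<Longrightarrow> apex (\<alpha> (y i)) = vs ! (Suc i mod m)"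
    by metis
  define x where "x i = y (i mod m)" for i
  have mod_less: "i mod m < m" for i using m by simp
  have x_in: "x i \<in> ?U" for i using y(1) mod_less by (simp add: x_def)
  have "bij_betw ((!) es) {..<m} (edge_of \<alpha> ` ?U)" using es m_def by (intro bij_betw_nth) auto
  then have bij: "bij_betw (\<lambda>i. edge_of \<alpha> (x i)) {..<m} (edge_of \<alpha> ` ?U)"
    by (rule bij_betw_cong[THEN iffD1, rotated]) (simp add: x_def y(2))
  have "edge_faces (x i) \<inter> edge_faces (x (Suc i)) \<noteq> {}" if i: "i < m" for i
  proof -
    have "es ! i = edge_of \<alpha> (x i)" "es ! (Suc i mod m) = edge_of \<alpha> (x (Suc i))"
      using y(2) mod_less i by (simp_all add: x_def)
    then show ?thesis using common[OF i] red_fe_iff[OF x_in] unfolding red_faces_def by auto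
  qed
  moreover have "apex (\<alpha> (x i)) = apex (x (Suc i))" if "i < m" for i
    using y(3,4) mod_less that by (simp add: x_def)
  moreover have "x m = x 0" by (simp add: x_def)
  ultimately show thesis using m bij x_in by (intro that)
qed

lemma two_factor_alternates:
  assumes "c \<in> {1, 2, 3}" "inv_closed B" "uncontracted c \<subseteq> B"
    and two: "\<And>d. d \<in> D \<Longrightarrow> card {x\<in>B. vert x = vert d} = 2" and d: "d \<in> D" "dcol d = c"
  shows "\<sigma> (\<alpha> d) \<in> B \<longleftrightarrow> d \<notin> B"
proof -
  let ?w = "\<alpha> d"
  have "\<sigma> (\<sigma> ?w) \<in> B" using uncontracted_iff[OF assms(1), of "\<sigma> (\<sigma> ?w)"] d assms(3) by auto
  moreover have "{x\<in>B. vert x = vert ?w} = vert ?w \<inter> B" using in_vert_iff[of _ ?w] by blast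
  then have "card ({?w, \<sigma> ?w, \<sigma> (\<sigma> ?w)} \<inter> B) = 2"
    using two[of ?w] cubic_rotation(1)[of ?w] d(1) by simp
  ultimately have "\<sigma> ?w \<in> B \<longleftrightarrow> ?w \<notin> B"
    using cubic_rotation(2,3)[of ?w] d(1) by (auto simp: Int_insert_left split: if_splits)
  then show ?thesis using inv_closedD[OF assms(2)] by blast
qed

text \<open>Using every second edge of each \<open>c\<close>-face, the 2-factor separates that face either from all its
  neighbours of colour \<open>a\<close> or from all those of colour \<open>b\<close>.\<close>
lemma two_factor_eq_boundary:
  assumes colours: "{a, b, c} = {1, 2, 3}" and B: "inv_closed B" "uncontracted c \<subseteq> B"
    and two: "\<And>d. d \<in> D \<Longrightarrow> card {x\<in>B. vert x = vert d} = 2"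
  obtains S where "region a b S" "boundary S = B"
proof -
  note distinct = colours_distinct[OF colours]
  have colour: "c \<in> {1, 2, 3}" using colours by blast
  have dcol: "dcol d = a \<or> dcol d = b \<or> dcol d = c" if "d \<in> D" for d
    using dcol_in[OF that] unfolding colours[symmetric] by blast
  define S where "S = {d\<in>D. dcol d = a \<or> dcol d = c \<and> (d \<in> B \<longleftrightarrow> dcol (\<alpha> d) = b)}"
  have flip: "dcol (\<alpha> (\<sigma> (\<alpha> y))) = b \<longleftrightarrow> dcol (\<alpha> y) \<noteq> b" if y: "y \<in> D" "dcol y = c" for y
    using dcol_rot_neq[of "\<alpha> y"] dcol[of "\<alpha> y"] dcol[of "\<sigma> (\<sigma> (\<alpha> y))"] y distinct by auto
  have "region a b S"
  proof (rule regionI)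
    show "{a, b} \<subseteq> {1, 2, 3}" using colours by blast
    show "\<sigma> (\<alpha> d) \<in> S \<longleftrightarrow> d \<in> S" if "d \<in> D" for d
      using two_factor_alternates[OF colour B two, of d] flip[of d] that
      by (cases "dcol d = c") (auto simp: S_def)
  qed (use distinct in \<open>auto simp: S_def\<close>)
  moreover have contracted: "d \<in> boundary S \<longleftrightarrow> d \<in> B" if "d \<in> D" "dcol d = c" for d
    using that dcol[of "\<alpha> d"] dcol_inv_neq[of d] distinct by (auto simp: boundary_def S_def)
  have "d \<in> boundary S \<longleftrightarrow> d \<in> B" if "d \<in> D" for d
  proof -
    consider (left) "dcol d = c" | (right) "dcol (\<alpha> d) = c" | (uncontracted) "d \<in> uncontracted c"
      using \<open>d \<in> D\<close> by (auto simp: uncontracted_def)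
    then show ?thesis
    proof cases
      case right
      then show ?thesis
        using contracted[of "\<alpha> d"] that inv_closedD[OF B(1)] inv_closedD[OF inv_closed_boundary]
        by simp
    next
      case uncontracted
      then show ?thesis
        using B(2) dcol[of d] dcol[of "\<alpha> d"] dcol_inv_neq[of d] distinct that
        by (auto simp: boundary_def S_def uncontracted_def)
    qed (use contracted that in blast)
  qed
  then have "boundary S = B"
    using inv_closed_subset[OF B(1)] inv_closed_subset[OF inv_closed_boundary] by blast
  ultimately show thesis by (rule that)
qed

text \<open>A trail with \<open>m\<close> edges passes all \<open>2 * m\<close> vertices, so the \<open>m\<close> edges joining its consecutive
  edges meet each vertex exactly once.\<close>
lemma dart_trail_joining_edges:
  assumes colour: "c \<in> {1, 2, 3}" and trail: "dart_trail c m x"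
  obtains L where "inv_closed L" "uncontracted c \<inter> L = {}" "bij_betw vert L verts"
    "\<And>i. i < m \<Longrightarrow> \<exists>z\<in>L. vert z = vert (\<alpha> (x i)) \<and> vert (\<alpha> z) = vert (x (Suc i))"
proof -
  have "\<forall>i\<in>{..<m}. \<exists>z. z \<in> D - uncontracted c \<and>
      vert z = vert (\<alpha> (x i)) \<and> vert (\<alpha> z) = vert (x (Suc i))"
    using trail unfolding dart_trail_def joined_def by blast
  then obtain z where z: "\<And>i. i < m \<Longrightarrow> z i \<in> D - uncontracted c"
    "\<And>i. i < m \<Longrightarrow> vert (z i) = vert (\<alpha> (x i))" "\<And>i. i < m \<Longrightarrow> vert (\<alpha> (z i)) = vert (x (Suc i))"
    by (metis bchoice lessThan_iff)
  define L where "L = z ` {..<m} \<union> (\<alpha> \<circ> z) ` {..<m}"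
  have zL: "z i \<in> L" "\<alpha> (z i) \<in> L" if "i < m" for i using that by (auto simp: L_def)
  have L: "inv_closed L" using z(1) by (auto simp: L_def inv_closed_def)
  have disjoint: "uncontracted c \<inter> L = {}"
    using z(1) inv_closedD[OF inv_closed_uncontracted] by (auto simp: L_def)
  have "v \<in> vert ` L" if "v \<in> verts" for v
  proof -
    obtain d where d: "d \<in> uncontracted c" "vert d = v"
      using colour \<open>v \<in> verts\<close> by (rule uncontracted_at_vert)
    from trail d(1) show ?thesis
    proof (cases rule: dart_trail_cases)
      case (tail i)
      then show ?thesis
        using z(2)[of i] zL(1)[of i] d(2) by (intro image_eqI[of _ _ "z i"]) simp_all
    next
      case (head i)
      then show ?thesis
        using z(3)[of i] zL(2)[of i] d(2) by (intro image_eqI[of _ _ "\<alpha> (z i)"]) simp_all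
    qed
  qed
  then have surj: "vert ` L = verts" using inv_closed_subset[OF L] by auto
  have "card L \<le> card (z ` {..<m}) + card ((\<alpha> \<circ> z) ` {..<m})" unfolding L_def by (rule card_Un_le)
  also have "\<dots> \<le> card verts"
    using card_image_le[of "{..<m}" z] card_image_le[of "{..<m}" "\<alpha> \<circ> z"]
      dart_trail_card[OF colour trail] by simp
  finally have "card L = card (vert ` L)"
    using card_image_le[OF inv_closed_finite[OF L], of vert] by (simp add: surj)
  then have "bij_betw vert L verts"
    using surj inv_closed_finite[OF L] by (simp add: bij_betw_def eq_card_imp_inj_on)
  with L disjoint show thesis by (rule that) (use z zL in blast)
qed

lemma dart_trail_connected:
  assumes colour: "c \<in> {1, 2, 3}" and trail: "dart_trail c m x"
    and B: "inv_closed B" "uncontracted c \<subseteq> B"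
    and joining: "\<And>i. i < m \<Longrightarrow> \<exists>z\<in>B. vert z = vert (\<alpha> (x i)) \<and> vert (\<alpha> z) = vert (x (Suc i))"
  shows "dart_connected vert B verts"
proof (rule dart_connectedI[OF B(1)])
  fix Q u v
  assume const: "\<And>d. d \<in> B \<Longrightarrow> Q (vert d) \<longleftrightarrow> Q (vert (\<alpha> d))" and uv: "u \<in> verts" "v \<in> verts" "Q u"
  have edge: "Q (vert (x i)) \<longleftrightarrow> Q (vert (\<alpha> (x i)))" if "i < m" for i
    using const[of "x i"] dart_trail_in[OF trail, of i] B(2) that by (auto simp: less_imp_le)
  have step: "Q (vert (x i)) \<longleftrightarrow> Q (vert (x (Suc i)))" if i: "i < m" for i
  proof -
    obtain z where "z \<in> B" "vert z = vert (\<alpha> (x i))" "vert (\<alpha> z) = vert (x (Suc i))"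
      using joining[OF i] by blast
    then show ?thesis using const[of z] edge[OF i] by simp
  qed
  have start: "Q (vert (x i)) \<longleftrightarrow> Q (vert (x 0))" if "i \<le> m" for i
    using that by (induction i) (use step in auto)
  have "Q w \<longleftrightarrow> Q (vert (x 0))" if w: "w \<in> verts" for w
  proof -
    obtain d where d: "d \<in> uncontracted c" "vert d = w"
      using colour w by (rule uncontracted_at_vert)
    from trail d(1) show ?thesis
    proof (cases rule: dart_trail_cases)
      case (tail i)
      then show ?thesis using edge[of i] start[of i] d(2) by auto
    next
      case (head i)
      then show ?thesis using start[of "Suc i"] d(2) by auto
    qed
  qed
  then show "Q v" using uv by blast
qed

lemma dart_trail_imp_ham_region:
  assumes colours: "{a, b, c} = {1, 2, 3}" and trail: "dart_trail c m x"
  shows "\<exists>S. ham_region a b S"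
proof -
  let ?U = "uncontracted c"
  have colour: "c \<in> {1, 2, 3}" using colours by blast
  obtain L where L: "inv_closed L" "?U \<inter> L = {}" "bij_betw vert L verts"
    and joining: "\<And>i. i < m \<Longrightarrow> \<exists>z\<in>L. vert z = vert (\<alpha> (x i)) \<and> vert (\<alpha> z) = vert (x (Suc i))"
    using dart_trail_joining_edges[OF colour trail] by metis
  have B: "inv_closed (?U \<union> L)"
    using L(1) inv_closed_uncontracted[of c] unfolding inv_closed_def by blast
  have two: "card {y\<in>?U \<union> L. vert y = vert d} = 2" if "d \<in> D" for d
    using bij_betw_vert_uncontracted[OF colour] L(3,2) that by (rule card_Un_at_vert)
  obtain S where S: "region a b S" "boundary S = ?U \<union> L"
    using two_factor_eq_boundary[OF colours B Un_upper1 two] by blast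
  have "dart_connected vert (?U \<union> L) verts"
    using colour trail B by (rule dart_trail_connected) (use joining in blast)+
  then show ?thesis using S by (auto simp: ham_region_def)
qed

text \<open>Follow the boundary with the region on the same side. The walk takes uncontracted and
  contracted edges in turn, so that every second step yields the A-trail.\<close>

definition boundary_next :: "'d set \<Rightarrow> 'd \<Rightarrow> 'd" where
  "boundary_next S d =
     (if d \<notin> oriented_boundary S then d
      else if \<sigma> (\<sigma> (\<alpha> d)) \<in> S then \<sigma> (\<sigma> (\<alpha> d)) else \<sigma> (\<alpha> d))"

lemma vert_boundary_next:
  "d \<in> oriented_boundary S \<Longrightarrow> vert (boundary_next S d) = vert (\<alpha> d)"
  by (simp add: boundary_next_def)

lemma boundary_next_in:
  assumes reg: "region a b S" and d: "d \<in> oriented_boundary S"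
  shows "boundary_next S d \<in> oriented_boundary S"
proof -
  have "d \<in> S" "\<alpha> d \<notin> S" using d by (simp_all add: oriented_boundary_def)
  moreover from this have "\<sigma> (\<alpha> d) \<in> S" using region_face_step[OF reg] by simp
  ultimately show ?thesis
    using region_inv[OF reg, of "\<sigma> (\<alpha> d)"] region_inv[OF reg, of "\<sigma> (\<sigma> (\<alpha> d))"] d
    by (simp add: boundary_next_def oriented_boundary_def)
qed

lemma finite_oriented_boundary: "region a b S \<Longrightarrow> finite (oriented_boundary S)"
  by (rule finite_subset[OF _ finite_darts]) (auto simp: oriented_boundary_def dest: region_subset)

lemma boundary_next_permutes:
  assumes reg: "region a b S" shows "boundary_next S permutes oriented_boundary S"
proof -
  have fin: "finite (oriented_boundary S)" using reg by (rule finite_oriented_boundary)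
  have sub: "boundary_next S ` oriented_boundary S \<subseteq> oriented_boundary S"
    using boundary_next_in[OF reg] by blast
  have inj: "inj_on (boundary_next S) (oriented_boundary S)"
  proof (rule inj_onI)
    fix d d' assume d: "d \<in> oriented_boundary S" "d' \<in> oriented_boundary S"
      "boundary_next S d = boundary_next S d'"
    then have "vert (\<alpha> d) = vert (\<alpha> d')" using vert_boundary_next by metis
    moreover have "\<alpha> d \<in> oriented_boundary (D - S)" "\<alpha> d' \<in> oriented_boundary (D - S)"
      using d(1,2) region_subset[OF reg] by (auto simp: oriented_boundary_def)
    moreover have "region b a (D - S)" using reg by (rule region_complement)
    ultimately have "\<alpha> d = \<alpha> d'" using oriented_boundary_eqI by blast
    then show "d = d'" by simp
  qed
  then have "bij_betw (boundary_next S) (oriented_boundary S) (oriented_boundary S)"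
    using endo_inj_surj[OF fin sub inj] by (simp add: bij_betw_def)
  then show ?thesis by (rule bij_imp_permutes) (simp add: boundary_next_def)
qed

lemma permutation_boundary_next:
  assumes "region a b S" shows "permutation (boundary_next S)"
  unfolding permutation_permutes
  using boundary_next_permutes[OF assms] finite_oriented_boundary[OF assms] by blast

lemma orbit_boundary_next:
  assumes S: "ham_region a b S" and d: "d \<in> oriented_boundary S"
  shows "orbit (boundary_next S) d = oriented_boundary S"
proof (rule equalityI)
  let ?O = "orbit (boundary_next S) d"
  have reg: "region a b S" and conn: "dart_connected vert (boundary S) verts"
    using S by (auto simp: ham_region_def)
  have inj: "inj_on vert (oriented_boundary S)"
    using bij_betw_vert_oriented_boundary[OF reg] by (rule bij_betw_imp_inj_on)
  show sub: "?O \<subseteq> oriented_boundary S"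
    using boundary_next_permutes[OF reg] d by (rule permutes_orbit_subset)
  have self: "d \<in> ?O" using permutation_boundary_next[OF reg] by (rule permutation_self_in_orbit)
  have next_iff: "boundary_next S x \<in> ?O \<longleftrightarrow> x \<in> ?O" for x
    using cyclic_on_f_in[OF boundary_next_permutes[OF reg]]
      cyclic_on_orbit'[OF permutation_boundary_next[OF reg]] orbit.step by metis
  have vert_iff: "vert x \<in> vert ` ?O \<longleftrightarrow> x \<in> ?O" if "x \<in> oriented_boundary S" for x
    using inj that sub by (rule inj_on_image_mem_iff)
  have walk: "vert x \<in> vert ` ?O \<longleftrightarrow> vert (\<alpha> x) \<in> vert ` ?O" if x: "x \<in> oriented_boundary S" for x
    using vert_iff[OF x] vert_iff[OF boundary_next_in[OF reg x]] next_iff[of x]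
    by (simp add: vert_boundary_next[OF x])
  have step: "vert x \<in> vert ` ?O \<longleftrightarrow> vert (\<alpha> x) \<in> vert ` ?O" if "x \<in> boundary S" for x
  proof (cases "x \<in> S")
    case True
    then show ?thesis using walk[of x] that by (simp add: boundary_def oriented_boundary_def)
  next
    case False
    then show ?thesis using walk[of "\<alpha> x"] that by (simp add: boundary_def oriented_boundary_def)
  qed
  show "oriented_boundary S \<subseteq> ?O"
  proof
    fix x assume x: "x \<in> oriented_boundary S"
    have verts: "vert d \<in> verts" "vert x \<in> verts"
      using d x region_subset[OF reg] by (auto simp: oriented_boundary_def)
    have "vert d \<in> vert ` ?O \<longleftrightarrow> vert x \<in> vert ` ?O"
      using conn step verts by (rule dart_connectedD[where Q = "\<lambda>v. v \<in> vert ` ?O"])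
    then show "x \<in> ?O" using self vert_iff[OF x] by blast
  qed
qed

lemma uncontracted_subset_boundary:
  assumes colours: "{a, b, c} = {1, 2, 3}" and reg: "region a b S"
  shows "uncontracted c \<subseteq> boundary S"
proof
  fix d assume d: "d \<in> uncontracted c"
  then have D: "d \<in> D" "dcol d \<noteq> c" "dcol (\<alpha> d) \<noteq> c" by (simp_all add: uncontracted_def)
  have side: "x \<in> S \<longleftrightarrow> dcol x = a" if "x \<in> D" "dcol x \<noteq> c" for x
  proof -
    have "dcol x = a \<or> dcol x = b"
      using dcol_in[OF that(1)] that(2) unfolding colours[symmetric] by blast
    moreover have "dcol x = a \<Longrightarrow> x \<in> S" "x \<in> S \<Longrightarrow> dcol x \<noteq> b"
      using reg that(1) by (simp_all add: region_def)
    ultimately show ?thesis by blast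
  qed
  have "dcol d = a \<or> dcol d = b" "dcol (\<alpha> d) = a \<or> dcol (\<alpha> d) = b"
    using dcol_in[of d] dcol_in[of "\<alpha> d"] D unfolding colours[symmetric] by simp_all
  then show "d \<in> boundary S"
    using side[of d] side[of "\<alpha> d"] D dcol_inv_neq[of d] by (auto simp: boundary_def)
qed

lemma uncontracted_boundary_next_iff:
  assumes colours: "{a, b, c} = {1, 2, 3}" and reg: "region a b S" and d: "d \<in> oriented_boundary S"
  shows "boundary_next S d \<in> uncontracted c \<longleftrightarrow> d \<notin> uncontracted c"
proof -
  let ?n = "boundary_next S d"
  have colour: "c \<in> {1, 2, 3}" using colours by blast
  have n: "?n \<in> oriented_boundary S" "vert ?n = vert (\<alpha> d)"
    using boundary_next_in[OF reg d] vert_boundary_next[OF d] by blast+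
  have ad: "\<alpha> d \<in> oriented_boundary (D - S)"
    using d region_subset[OF reg] by (auto simp: oriented_boundary_def)
  have "vert ?n \<in> verts" using n(1) region_subset[OF reg] by (auto simp: oriented_boundary_def)
  then obtain u where u: "u \<in> uncontracted c" "vert u = vert ?n"
    by (rule uncontracted_at_vert[OF colour])
  have "u \<in> oriented_boundary S \<or> u \<in> oriented_boundary (D - S)"
    using uncontracted_subset_boundary[OF colours reg] u(1) boundary_eq_Un[OF region_subset[OF reg]]
    by blast
  then have "u = ?n \<or> u = \<alpha> d"
    using oriented_boundary_eqI[OF reg, of u ?n]
      oriented_boundary_eqI[OF region_complement[OF reg], of u "\<alpha> d"] u(2) n ad by metis
  moreover have "\<not> (?n \<in> uncontracted c \<and> \<alpha> d \<in> uncontracted c)"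
    using uncontracted_eqI[OF colour _ _ n(2)] n(1) ad by (auto simp: oriented_boundary_def)
  ultimately show ?thesis using u(1) inv_closedD[OF inv_closed_uncontracted] by blast
qed

lemma uncontracted_boundary_walk_iff:
  assumes colours: "{a, b, c} = {1, 2, 3}" and reg: "region a b S"
    and d: "d \<in> oriented_boundary S" "d \<in> uncontracted c"
  shows "(boundary_next S ^^ i) d \<in> oriented_boundary S"
    "(boundary_next S ^^ i) d \<in> uncontracted c \<longleftrightarrow> even i"
proof -
  show walk: "(boundary_next S ^^ i) d \<in> oriented_boundary S" for i
    by (induction i) (use d(1) boundary_next_in[OF reg] in simp_all)
  show "(boundary_next S ^^ i) d \<in> uncontracted c \<longleftrightarrow> even i"
    by (induction i) (use d(2) uncontracted_boundary_next_iff[OF colours reg walk] in simp_all)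
qed

lemma uncontracted_oriented:
  assumes "{a, b, c} = {1, 2, 3}" "region a b S" "d \<in> uncontracted c"
  shows "d \<in> oriented_boundary S \<or> \<alpha> d \<in> oriented_boundary S"
  using uncontracted_subset_boundary[OF assms(1,2)] assms(3)
  by (auto simp: boundary_def oriented_boundary_def)

lemma boundary_walk_cycle:
  assumes "ham_region a b S" "d \<in> oriented_boundary S"
  obtains n where "0 < n" "(boundary_next S ^^ n) d = d"
    "bij_betw (\<lambda>i. (boundary_next S ^^ i) d) {..<n} (oriented_boundary S)"
proof -
  let ?n = "funpow_dist1 (boundary_next S) d d"
  have "region a b S" using assms(1) by (simp add: ham_region_def)
  then have self: "d \<in> orbit (boundary_next S) d"
    using permutation_boundary_next by (intro permutation_self_in_orbit)
  have "bij_betw (\<lambda>i. (boundary_next S ^^ i) d) {..<?n} (oriented_boundary S)"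
    using inj_on_funpow_dist1[OF self] orbit_conv_funpow_dist1[OF self]
      orbit_boundary_next[OF assms]
    by (simp add: bij_betw_def lessThan_atLeast0)
  then show thesis using funpow_dist1_prop[OF self] by (intro that[of ?n]) simp_all
qed

lemma bij_betw_boundary_walk_uncontracted_edges:
  assumes colours: "{a, b, c} = {1, 2, 3}" and reg: "region a b S"
    and d: "d \<in> oriented_boundary S" "d \<in> uncontracted c"
    and bij: "bij_betw (\<lambda>i. (boundary_next S ^^ i) d) {..<2 * m} (oriented_boundary S)"
  shows "bij_betw (\<lambda>i. edge_of \<alpha> ((boundary_next S ^^ (2 * i)) d)) {..<m}
    (edge_of \<alpha> ` uncontracted c)"
proof (rule bij_betw_imageI)
  define y where "y i = (boundary_next S ^^ i) d" for i
  note bij_y = bij[folded y_def]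
  note walk = uncontracted_boundary_walk_iff[OF colours reg d, folded y_def]
  show "inj_on (\<lambda>i. edge_of \<alpha> ((boundary_next S ^^ (2 * i)) d)) {..<m}"
    unfolding y_def[symmetric]
  proof (rule inj_onI)
    fix i j assume ij: "i \<in> {..<m}" "j \<in> {..<m}" "edge_of \<alpha> (y (2 * i)) = edge_of \<alpha> (y (2 * j))"
    have "y (2 * i) \<noteq> \<alpha> (y (2 * j))"
      using walk(1)[of "2 * i"] walk(1)[of "2 * j"] by (auto simp: oriented_boundary_def)
    then have "y (2 * i) = y (2 * j)" using ij(3) by (simp add: edge_of_eq_iff)
    then show "i = j"
      using inj_onD[OF bij_betw_imp_inj_on[OF bij_y], of "2 * i" "2 * j"] ij(1,2) by simp
  qed
  show "(\<lambda>i. edge_of \<alpha> ((boundary_next S ^^ (2 * i)) d)) ` {..<m} = edge_of \<alpha> ` uncontracted c"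
    unfolding y_def[symmetric]
  proof (intro equalityI subsetI)
    fix e assume "e \<in> edge_of \<alpha> ` uncontracted c"
    then obtain u where u: "u \<in> uncontracted c" "u \<in> oriented_boundary S" "e = edge_of \<alpha> u"
      using uncontracted_oriented[OF colours reg] inv_closedD[OF inv_closed_uncontracted]
      by (metis edge_of_inv imageE)
    then have "u \<in> y ` {..<2 * m}" using bij_betw_imp_surj_on[OF bij_y] by simp
    then obtain k where k: "k < 2 * m" "u = y k" by auto
    then obtain i where "k = 2 * i" using u(1) walk(2) by (metis evenE)
    then show "e \<in> (\<lambda>i. edge_of \<alpha> (y (2 * i))) ` {..<m}" using k u(3) by auto
  qed (use walk(2) in auto)
qed

lemma ham_region_imp_dart_trail:
  assumes colours: "{a, b, c} = {1, 2, 3}" and S: "ham_region a b S"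
  shows "\<exists>m x. dart_trail c m x"
proof -
  have reg: "region a b S" using S by (simp add: ham_region_def)
  have colour: "c \<in> {1, 2, 3}" using colours by blast
  obtain e where "vert e \<in> verts" using darts_nonempty by auto
  then obtain u where "u \<in> uncontracted c" by (rule uncontracted_at_vert[OF colour])
  then obtain d where d: "d \<in> oriented_boundary S" "d \<in> uncontracted c"
    using uncontracted_oriented[OF colours reg] inv_closedD[OF inv_closed_uncontracted] by blast
  define y where "y i = (boundary_next S ^^ i) d" for i
  note walk = uncontracted_boundary_walk_iff[OF colours reg d, folded y_def]
  obtain n where n: "0 < n" "y n = d" "bij_betw y {..<n} (oriented_boundary S)"
    using boundary_walk_cycle[OF S d(1)] by (auto simp: y_def[abs_def])
  then have "even n" using walk(2) d(2) by metis
  then obtain m where m: "n = 2 * m" by blast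
  have vert_y: "vert (y (Suc i)) = vert (\<alpha> (y i))" for i
    using vert_boundary_next[OF walk(1)] by (simp add: y_def)
  have "joined c (\<alpha> (y (2 * i))) (y (2 * Suc i))" for i
    unfolding joined_def
  proof (rule bexI)
    show "y (Suc (2 * i)) \<in> D - uncontracted c"
      using walk[of "Suc (2 * i)"] region_subset[OF reg] by (auto simp: oriented_boundary_def)
  qed (simp add: vert_y)
  moreover have "bij_betw (\<lambda>i. edge_of \<alpha> (y (2 * i))) {..<m} (edge_of \<alpha> ` uncontracted c)"
    using n(3) bij_betw_boundary_walk_uncontracted_edges[OF colours reg d, of m]
    by (simp add: y_def[abs_def] m)
  moreover have "0 < m" "y (2 * m) = y (2 * 0)" using n(1,2) m by (simp_all add: y_def)
  ultimately have "dart_trail c m (\<lambda>i. y (2 * i))" unfolding dart_trail_def by blast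
  then show ?thesis by blast
qed

end

section \<open>Face-coloured Barnette graphs\<close>

locale coloured_barnette = coloured_cubic_map +
  assumes simple: "map_simple D \<alpha> \<sigma>" and three_connected: "map_3_connected D \<alpha> \<sigma>"
begin

lemma common_edge_unique:
  assumes "d \<in> D" "d' \<in> D" "face d' = face d" "face (\<alpha> d') = face (\<alpha> d)"
  shows "d' = d"
proof (rule ccontr)
  assume "d' \<noteq> d"
  moreover have "d' \<noteq> \<alpha> d" using assms(1,3) dcol_inv_neq[of d] by auto
  ultimately show False
    using double_dual_edge_disconnects assms three_connected_delete_two_edges[OF three_connected]
    by blast
qed

lemma face_step2_neq:
  assumes "d \<in> D" shows "\<sigma> (\<alpha> (\<sigma> (\<alpha> d))) \<noteq> d"
proof
  let ?e = "\<alpha> (\<sigma> (\<alpha> d))"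
  assume step2: "\<sigma> ?e = d"
  then have "vert ?e = vert d" "vert (\<alpha> ?e) = vert (\<alpha> d)" using vert_rot[of ?e] by simp_all
  moreover have "?e \<in> D" using assms by simp
  ultimately have "?e = d" using simple assms unfolding map_simple_def by blast
  then show False using step2 cubic_rotation(2)[OF assms] by simp
qed

lemma ex_other_face_of_colour:
  assumes "a \<in> {1, 2, 3}"
  obtains F where "F \<in> faces" "col F = a" "F \<noteq> X"
proof -
  obtain e where "e \<in> D" using darts_nonempty by blast
  then obtain x where x: "x \<in> D" "dcol x = a" using vert_colour assms by metis
  let ?d = "\<alpha> x" and ?y = "\<alpha> (\<sigma> (\<alpha> (\<sigma> x)))"
  have "dcol ?y = a" using dcol_inv_face_step2[of ?d] x by simp
  moreover have "face ?y \<noteq> face x"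
    using common_edge_unique[of ?d "\<alpha> ?y"] face_step2_neq[of ?d] x(1)
      face_step[of ?d] face_step[of "\<sigma> x"]
    by auto
  moreover have "?y \<in> D" using x(1) by simp
  ultimately show thesis using that[of "face ?y"] that[of "face x"] x face_in_iff by metis
qed

lemma sg_tree_iff_ham_region:
  assumes "{a, b, c} = {1, 2, 3}" "region a b S"
  shows "sg_tree (radial_node a ` face ` S) (radial_adj (red_fv D \<sigma>)) \<longleftrightarrow> ham_region a b S"
proof -
  let ?N = "interior_darts S"
  have SD: "S \<subseteq> D" using assms(2) by (rule region_subset)
  then have ND: "?N \<subseteq> D" by (auto simp: interior_darts_def)
  have "sg_tree (radial_node a ` face ` S) (radial_adj (red_fv D \<sigma>)) \<longleftrightarrow>
      sg_tree (face ` S) (\<lambda>X Y. (X, Y) \<in> dart_rel face ?N)"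
  proof (rule sg_tree_image_iff)
    show "inj_on (radial_node a) (face ` S)"
      by (auto simp: inj_on_def radial_node_def split: if_splits)
  qed (rule radial_adj_iff[OF assms])
  also have "\<dots> \<longleftrightarrow> dart_tree face ?N (face ` S)"
  proof (rule sg_tree_iff_dart_tree)
    show "inv_closed ?N" using SD by (rule inv_closed_interior)
    show "face ` ?N \<subseteq> face ` S" by (auto simp: interior_darts_def)
    obtain e where "e \<in> D" using darts_nonempty by blast
    then show "face ` S \<noteq> {}" using region_vert[OF assms(2), of "vert e"] by auto
    show "inj_on (\<lambda>d. (face d, face (\<alpha> d))) ?N"
      using ND common_edge_unique by (intro inj_onI) blast
    show "face (\<alpha> d) \<noteq> face d" if "d \<in> ?N" for d using that ND dcol_inv_neq[of d] by auto
  qed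
  also have "\<dots> \<longleftrightarrow> ham_region a b S" using ham_region_iff_dart_tree[OF assms(2)] by simp
  finally show ?thesis .
qed

lemma ham_region_contracted_face_adjacent:
  assumes "ham_region a b S" "a \<in> {1, 2, 3}" "X \<in> faces" "col X = a"
  obtains z where "z \<in> interior_darts S" "face z = X"
proof -
  have reg: "region a b S" and conn: "dart_connected face (interior_darts S) (face ` S)"
    using assms(1) ham_region_interior_connected by (auto simp: ham_region_def)
  obtain Y where Y: "Y \<in> faces" "col Y = a" "Y \<noteq> X" using ex_other_face_of_colour[OF assms(2)] .
  have "F \<in> face ` S" if "F \<in> faces" "col F = a" for F
    using that reg by (elim facesE) (auto simp: region_def)
  then have "(X, Y) \<in> (dart_rel face (interior_darts S))\<^sup>*"
    using conn assms(3,4) Y unfolding dart_connected_def by blast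
  then obtain Z where "(X, Z) \<in> dart_rel face (interior_darts S)"
    using Y(3) by (auto elim: converse_rtranclE)
  then show thesis using that by (auto simp: dart_rel_def)
qed

lemma is_spanning_tree_of_faces_iff_ham_region:
  assumes colours: "{a, b, c} = {1, 2, 3}" and "col outer \<noteq> c"
    and T: "T \<subseteq> faces" "\<forall>F\<in>T. col F = c"
  shows "is_spanning_tree_of_faces (red_verts D \<alpha> \<sigma> col a) (red_faces D \<alpha> \<sigma> col a)
      (red_fe D \<alpha> \<sigma> col a) (red_fv D \<sigma>) outer T \<longleftrightarrow> ham_region a b (face_region a T)"
    (is "?tree \<longleftrightarrow> ?ham")
proof -
  let ?V = "red_verts D \<alpha> \<sigma> col a" and ?S = "face_region a T"
  have reg: "region a b ?S" using colours T(2) by (rule region_face_region)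
  have "a \<noteq> c" using colours by (rule colours_distinct)
  then have "radial_node a ` (?V \<union> T) = Inl ` ?V \<union> Inr ` T"
    using T(2) by (auto simp: radial_node_def red_verts_def image_Un intro!: image_cong)
  then have tree_iff: "sg_tree (Inl ` ?V \<union> Inr ` T) (radial_adj (red_fv D \<sigma>)) \<longleftrightarrow> ?ham"
    using sg_tree_iff_ham_region[OF colours reg] by (simp add: face_image_face_region[OF T(1)])
  have sub: "T \<subseteq> red_faces D \<alpha> \<sigma> col a - {outer}"
    using T \<open>a \<noteq> c\<close> \<open>col outer \<noteq> c\<close> by (auto simp: red_faces_def)
  have disjoint: "\<not> (\<exists>e. red_fe D \<alpha> \<sigma> col a F e \<and> red_fe D \<alpha> \<sigma> col a F' e)"
    if "F \<in> T" "F' \<in> T" "F \<noteq> F'" for F F'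
    by (rule red_fe_disjoint) (use that T in auto)
  have cover: "\<exists>F\<in>T. red_fv D \<sigma> F X" if ham: ?ham and X: "X \<in> ?V" for X
  proof -
    have X': "X \<in> faces" "col X = a" using X by (simp_all add: red_verts_def)
    have a: "a \<in> {1, 2, 3}" using colours by blast
    obtain z where z: "z \<in> interior_darts ?S" "face z = X"
      using ham_region_contracted_face_adjacent[OF ham a X'] .
    then have "z \<in> D" "dcol (\<alpha> z) \<noteq> a" "\<alpha> z \<in> ?S"
      using X'(2) dcol_inv_neq[of z] by (auto simp: interior_darts_def face_region_def)
    moreover from this have "face (\<alpha> z) \<in> T" by (simp add: face_region_def)
    ultimately show ?thesis using red_fv_iff[OF X'(1), of "face (\<alpha> z)"] T(1) X'(2) z(2) by blast
  qed
  show ?thesis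
    unfolding is_spanning_tree_of_faces_def using tree_iff sub disjoint cover by blast
qed

theorem reduced_has_sptf_iff_ham_region:
  assumes colours: "{a, b, c} = {1, 2, 3}" and "col outer \<noteq> c"
  shows "reduced_has_sptf D \<alpha> \<sigma> col outer a c \<longleftrightarrow> (\<exists>S. ham_region a b S)"
proof
  assume "reduced_has_sptf D \<alpha> \<sigma> col outer a c"
  then obtain T where T: "is_spanning_tree_of_faces (red_verts D \<alpha> \<sigma> col a) (red_faces D \<alpha> \<sigma> col a)
      (red_fe D \<alpha> \<sigma> col a) (red_fv D \<sigma>) outer T" "\<forall>F\<in>T. col F = c"
    by (auto simp: reduced_has_sptf_def)
  then have "T \<subseteq> faces" by (auto simp: is_spanning_tree_of_faces_def red_faces_def)
  then show "\<exists>S. ham_region a b S" using is_spanning_tree_of_faces_iff_ham_region assms T by blast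
next
  assume "\<exists>S. ham_region a b S"
  then obtain S where S: "ham_region a b S" by blast
  let ?T = "{F \<in> face ` S. col F = c}"
  have reg: "region a b S" using S by (simp add: ham_region_def)
  have "?T \<subseteq> faces" using region_subset[OF reg] by auto
  moreover have "ham_region a b (face_region a ?T)"
    using S region_eq_face_region[OF colours reg] by simp
  ultimately show "reduced_has_sptf D \<alpha> \<sigma> col outer a c"
    unfolding reduced_has_sptf_def
    using is_spanning_tree_of_faces_iff_ham_region[OF assms, of ?T] by blast
qed

lemma edge_faces_eqD:
  assumes "x \<in> D" "y \<in> D" "edge_faces x = edge_faces y" shows "x = y \<or> x = \<alpha> y"
  using assms(3) common_edge_unique[OF assms(2,1)] common_edge_unique[of "\<alpha> y" x] assms(1,2)
  by (auto simp: edge_faces_def doubleton_eq_iff simp del: face_inv)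

lemma joinedI:
  assumes colour: "c \<in> {1, 2, 3}" and d: "d \<in> uncontracted c" "d' \<in> uncontracted c" "d \<noteq> d'"
    and "apex d = apex d'" "F \<in> edge_faces d" "F \<in> edge_faces d'"
  shows "joined c d d'"
proof -
  have D: "d \<in> D" "d' \<in> D" using d by (simp_all add: uncontracted_def)
  obtain z where z: "vert z = vert d" "z \<in> D" "edge_faces z = {apex d, F}"
    using ex_dart_at_vert_with_edge_faces[OF D(1) assms(6)] .
  obtain z' where z': "vert z' = vert d'" "z' \<in> D" "edge_faces z' = {apex d', F}"
    using ex_dart_at_vert_with_edge_faces[OF D(2) assms(7)] .
  have "z' = z \<or> z' = \<alpha> z" using edge_faces_eqD[OF z'(2) z(2)] z(3) z'(3) assms(5) by simp
  moreover have "vert d \<noteq> vert d'" using uncontracted_eqI[OF colour d(1,2)] d(3) by blast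
  ultimately have "vert (\<alpha> z) = vert d'" using z(1) z'(1) by auto
  moreover have "z \<notin> uncontracted c"
    using apex_in_red_verts[OF colour d(1)] z(3)
    by (auto simp: red_verts_def uncontracted_def edge_faces_def doubleton_eq_iff)
  ultimately show ?thesis using z(1,2) by (auto simp: joined_def)
qed

lemma reduced_has_A_trail_imp_dart_trail:
  assumes colour: "c \<in> {1, 2, 3}" and "reduced_has_A_trail D \<alpha> \<sigma> col c"
  shows "\<exists>m x. dart_trail c m x"
proof -
  obtain m x where m: "0 < m" "x m = x 0"
    and bij: "bij_betw (\<lambda>i. edge_of \<alpha> (x i)) {..<m} (edge_of \<alpha> ` uncontracted c)"
    and x_in: "\<And>i. x i \<in> uncontracted c"
    and apex: "\<And>i. i < m \<Longrightarrow> apex (\<alpha> (x i)) = apex (x (Suc i))"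
    and common: "\<And>i. i < m \<Longrightarrow> edge_faces (x i) \<inter> edge_faces (x (Suc i)) \<noteq> {}"
    using assms by (rule reduced_has_A_trailE) blast
  have "joined c (\<alpha> (x i)) (x (Suc i))" if i: "i < m" for i
  proof -
    have "\<alpha> (x i) \<noteq> x (Suc i)"
    proof
      assume opposite: "\<alpha> (x i) = x (Suc i)"
      then have edges: "edge_of \<alpha> (x i) = edge_of \<alpha> (x (Suc i))" by (metis edge_of_inv)
      have "x (Suc i) = x i"
      proof (cases "Suc i = m")
        case True
        then show ?thesis using inj_onD[OF bij_betw_imp_inj_on[OF bij], of i 0] edges m i by simp
      next
        case False
        then show ?thesis
          using inj_onD[OF bij_betw_imp_inj_on[OF bij], of i "Suc i"] edges i by simp
      qed
      then show False using opposite inv_neq[of "x i"] x_in[of i] by (simp add: uncontracted_def)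
    qed
    moreover have "\<alpha> (x i) \<in> uncontracted c"
      using x_in inv_closedD[OF inv_closed_uncontracted] by blast
    moreover obtain F where "F \<in> edge_faces (\<alpha> (x i))" "F \<in> edge_faces (x (Suc i))"
      using common[OF i] unfolding edge_faces_inv by blast
    ultimately show ?thesis using joinedI[OF colour _ x_in _ apex[OF i]] by blast
  qed
  then show ?thesis using m bij unfolding dart_trail_def by blast
qed

theorem reduced_has_A_trail_iff_ham_region:
  assumes "{a, b, c} = {1, 2, 3}"
  shows "reduced_has_A_trail D \<alpha> \<sigma> col c \<longleftrightarrow> (\<exists>S. ham_region a b S)"
proof -
  have "c \<in> {1, 2, 3}" using assms by blast
  then have "reduced_has_A_trail D \<alpha> \<sigma> col c \<longleftrightarrow> (\<exists>m x. dart_trail c m x)"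
    using reduced_has_A_trail_imp_dart_trail dart_trail_imp_reduced_has_A_trail by blast
  also have "\<dots> \<longleftrightarrow> (\<exists>S. ham_region a b S)"
    using dart_trail_imp_ham_region[OF assms] ham_region_imp_dart_trail[OF assms] by blast
  finally show ?thesis .
qed

end

theorem theorem2:
  fixes D :: "'d set" and \<alpha> \<sigma> :: "'d \<Rightarrow> 'd"
    and col :: "'d set \<Rightarrow> nat" and outer :: "'d set"
  assumes "barnette D \<alpha> \<sigma>"
    and "proper_face_3_coloring D \<alpha> \<sigma> col"
    and "outer \<in> map_faces D \<alpha> \<sigma>"
    and "col outer = 3"
  shows "((\<exists>C. ham_cycle D \<alpha> \<sigma> C \<and>
             (\<forall>F\<in>map_faces D \<alpha> \<sigma>. col F = 2 \<longrightarrow> F \<notin> outside_faces D \<alpha> \<sigma> C outer) \<and>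
             (\<forall>F\<in>map_faces D \<alpha> \<sigma>. col F = 3 \<longrightarrow> F \<in> outside_faces D \<alpha> \<sigma> C outer))
          \<longleftrightarrow> reduced_has_A_trail D \<alpha> \<sigma> col 1)
       \<and> (reduced_has_A_trail D \<alpha> \<sigma> col 1 \<longleftrightarrow> reduced_has_sptf D \<alpha> \<sigma> col outer 2 1)
       \<and> (reduced_has_sptf D \<alpha> \<sigma> col outer 2 1 \<longleftrightarrow> reduced_has_sptf D \<alpha> \<sigma> col outer 3 1)"
proof -
  interpret coloured_barnette D \<alpha> \<sigma> col
    using assms(1,2) by unfold_locales (simp_all add: barnette_def)
  have colours: "{2, 3, 1} = {1, 2, 3 :: nat}" "{3, 2, 1} = {1, 2, 3 :: nat}" by auto
  have "reduced_has_A_trail D \<alpha> \<sigma> col 1 \<longleftrightarrow> (\<exists>S. ham_region 2 3 S)"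
    using colours(1) by (rule reduced_has_A_trail_iff_ham_region)
  moreover have "reduced_has_sptf D \<alpha> \<sigma> col outer 2 1 \<longleftrightarrow> (\<exists>S. ham_region 2 3 S)"
    using colours(1) assms(4) by (intro reduced_has_sptf_iff_ham_region) simp_all
  moreover have "reduced_has_sptf D \<alpha> \<sigma> col outer 3 1 \<longleftrightarrow> (\<exists>S. ham_region 3 2 S)"
    using colours(2) assms(4) by (intro reduced_has_sptf_iff_ham_region) simp_all
  moreover have "(\<exists>S. ham_region 2 3 S) \<longleftrightarrow> (\<exists>S. ham_region 3 2 S)"
    using ham_region_complement by blast
  ultimately show ?thesis using ham_cycle_iff_ham_region[OF assms(3,4), of 2] by simp
qed

end
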